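(* Let $C\subset V$ be an open cone containing no lines, and fix a basepoint $b\in C$. Then the set of Busemann points of the Hilbert geometry on $C$ is $$\{\, r_{C,z}+ f_{T,p}|_C \;:\; z\in\partial C\setminus\{0\},\ T\in\mathscr{T}(\tau(C,z)),\ p\in T\,\}.$$
   Context: $V$ is a finite-dimensional real vector space. An open cone is a nonempty open convex set $T\subset V$ with $\lambda T\subseteq T$ for all $\lambda>0$ and $0\notin T$; $\partial T$ is its boundary in $V$ and $\overline{T}$ its closure. Write $x\le_T y$ iff $y-x\in\overline T$, and $[0]_T:=\overline T\cap(-\overline T)$. For $y\in V$, $x\in T$ put $M_T(y/x):=\inf\{\lambda>0: y\le_T\lambda x\}$ and $F_T(y,x):=\log M_T(y/x)$ (Funk function). The Hilbert function on $C$ is $H_C(x,y):=F_C(x,y)+F_C(y,x)$ for $x,y\in C$. For an open cone $T$ and $x\in\partial T$, the open tangent cone is $\tau(T,x):=\{\lambda(y-x):\lambda>0,\ y\in T\}$. For a set $\mathbb T$ of cones, $\Gamma(\mathbb T):=\{\tau(T,x): T\in\mathbb T,\ x\in\partial T\}$, and $\mathscr T(T):=\bigcup_{k\ge1}\Gamma^k(\{T\})$ (so $T\in\mathscr T(T)$ and every element of $\mathscr T(\tau(C,z))$ contains $C$, hence $b$). For an open cone $T\ni b$ and $p\in T$, $f_{T,p}:T\to\mathbb R$, $f_{T,p}(x):=F_T(x,p)-F_T(b,p)$; for $p\in\partial T\setminus[0]_T$, $r_{T,p}:T\to\mathbb R$, $r_{T,p}(x):=F_T(p,x)-F_T(p,b)$.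 $f|_S$ denotes restriction to $S$. An almost-geodesic for a function $d$ on $C\times C$ satisfying the triangle inequality is a sequence $(x_l)_{l\in\mathbb N}$ in $C$ such that for some $\epsilon>0$, $\sum_{i=1}^l d(x_{i-1},x_i)\le d(x_0,x_l)+\epsilon$ for all $l\ge1$. A sequence $(x_n)$ in $C$ converges in the $d$-sense to $g:C\to\mathbb R$ if $d(\cdot,x_n)-d(b,x_n)\to g$ pointwise on $C$. A horofunction of $d$ is such a limit $g$ of a sequence in $C$ which is not of the form $d(\cdot,p)-d(b,p)$ with $p\in C$; a Busemann point is a limit in the $d$-sense of an almost-geodesic which is not of the form $d(\cdot,p)-d(b,p)$ with $p\in C$. "Hilbert geometry on $C$" means $d=H_C$. *)

theory Defs
  imports "HOL-Analysis.Analysis" "HOL-Library.FuncSet"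
begin

definition open_cone :: "'a::euclidean_space set \<Rightarrow> bool" where
  "open_cone T \<longleftrightarrow> T \<noteq> {} \<and> open T \<and> convex T \<and>
     (\<forall>c>0. (\<lambda>x. c *\<^sub>R x) ` T \<subseteq> T) \<and> 0 \<notin> T"

definition contains_no_lines :: "'a::real_vector set \<Rightarrow> bool" where
  "contains_no_lines C \<longleftrightarrow> \<not> (\<exists>x v. v \<noteq> 0 \<and> (\<forall>t::real. x + t *\<^sub>R v \<in> C))"

definition cone_le :: "'a::euclidean_space set \<Rightarrow> 'a \<Rightarrow> 'a \<Rightarrow> bool" where
  "cone_le T x y \<longleftrightarrow> y - x \<in> closure T"

definition zero_class :: "'a::euclidean_space set \<Rightarrow> 'a set" where
  "zero_class T = closure T \<inter> uminus ` closure T"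

definition Mfun :: "'a::euclidean_space set \<Rightarrow> 'a \<Rightarrow> 'a \<Rightarrow> real" where
  "Mfun T y x = Inf {c. c > 0 \<and> cone_le T y (c *\<^sub>R x)}"

definition Funk :: "'a::euclidean_space set \<Rightarrow> 'a \<Rightarrow> 'a \<Rightarrow> real" where
  "Funk T y x = ln (Mfun T y x)"

definition Hilbert :: "'a::euclidean_space set \<Rightarrow> 'a \<Rightarrow> 'a \<Rightarrow> real" where
  "Hilbert C x y = Funk C x y + Funk C y x"

definition tangent_cone :: "'a::euclidean_space set \<Rightarrow> 'a \<Rightarrow> 'a set" where
  "tangent_cone T x = {c *\<^sub>R (y - x) | c y. c > 0 \<and> y \<in> T}"

definition Gamma :: "'a::euclidean_space set set \<Rightarrow> 'a set set" where
  "Gamma TT = {tangent_cone T x | T x. T \<in> TT \<and> x \<in> frontier T}"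

definition iter_tangent_cones :: "'a::euclidean_space set \<Rightarrow> 'a set set" where
  "iter_tangent_cones T = (\<Union>k\<in>{1..}. (Gamma ^^ k) {T})"

definition f_fun :: "'a::euclidean_space \<Rightarrow> 'a set \<Rightarrow> 'a \<Rightarrow> 'a \<Rightarrow> real" where
  "f_fun b T p x = Funk T x p - Funk T b p"

definition r_fun :: "'a::euclidean_space \<Rightarrow> 'a set \<Rightarrow> 'a \<Rightarrow> 'a \<Rightarrow> real" where
  "r_fun b T p x = Funk T p x - Funk T p b"

definition almost_geodesic :: "'a set \<Rightarrow> ('a \<Rightarrow> 'a \<Rightarrow> real) \<Rightarrow> (nat \<Rightarrow> 'a) \<Rightarrow> bool" where
  "almost_geodesic C d xs \<longleftrightarrow> (\<forall>n. xs n \<in> C) \<and>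
     (\<exists>\<epsilon>>0. \<forall>l\<ge>1. (\<Sum>i=1..l. d (xs (i - 1)) (xs i)) \<le> d (xs 0) (xs l) + \<epsilon>)"

text \<open>Functions on C are represented as extensional functions (undefined off C).\<close>
definition converges_d :: "'a set \<Rightarrow> ('a \<Rightarrow> 'a \<Rightarrow> real) \<Rightarrow> 'a \<Rightarrow> (nat \<Rightarrow> 'a) \<Rightarrow> ('a \<Rightarrow> real) \<Rightarrow> bool" where
  "converges_d C d b xs g \<longleftrightarrow>
     (\<forall>y\<in>C. (\<lambda>n. d y (xs n) - d b (xs n)) \<longlonglongrightarrow> g y)"

definition Busemann_points :: "'a set \<Rightarrow> ('a \<Rightarrow> 'a \<Rightarrow> real) \<Rightarrow> 'a \<Rightarrow> ('a \<Rightarrow> real) set" where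
  "Busemann_points C d b = {g. g \<in> extensional C \<and>
     (\<exists>xs. almost_geodesic C d xs \<and> converges_d C d b xs g) \<and>
     \<not> (\<exists>p\<in>C. \<forall>y\<in>C. g y = d y p - d b p)}"

end

theory Submission
  imports Defs
begin

text \<open>Up to rescaling its terms, an almost-geodesic of the Funk function of \<open>T\<close> is a sequence that
  increases for \<open>\<le>\<^sub>T\<close> and along which \<open>M\<^sub>T(w/\<cdot>)\<close> stays away from 0.  Modulo the lineality space of
  \<open>T\<close>, such a sequence either converges in \<open>T\<close> or escapes in a boundary direction \<open>z\<close>; in the second
  case \<open>T\<close> and \<open>\<tau>(T,z)\<close> give the same limit, and the lineality space grows, so after finitely
  many steps the limit is \<open>f\<^sub>T\<^sub>,\<^sub>p\<close> for an iterated tangent cone.  A Hilbert almost-geodesic is also one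
  for the Funk function, and its direction \<open>z\<close> yields the summand \<open>r\<^sub>C\<^sub>,\<^sub>z\<close>.

  Conversely, every compact subset of an iterated tangent cone \<open>T\<close> can be moved into \<open>C\<close> by a
  vector of the lineality space of \<open>T\<close>, which leaves \<open>M\<^sub>T\<close> unchanged.  Translating \<open>p\<close> by such
  vectors, chosen successively large enough, gives an almost-geodesic with the required limit.\<close>

subsection \<open>Closures and lineality spaces of open cones\<close>

lemma open_cone_scale: "open_cone T \<Longrightarrow> x \<in> T \<Longrightarrow> c > 0 \<Longrightarrow> c *\<^sub>R x \<in> T"
  unfolding open_cone_def by blast

lemma open_cone_open: "open_cone T \<Longrightarrow> open T"
  unfolding open_cone_def by blast

lemma open_cone_zero: "open_cone T \<Longrightarrow> 0 \<notin> T"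
  unfolding open_cone_def by blast

lemma open_cone_add:
  assumes "open_cone T" "x \<in> T" "y \<in> T"
  shows "x + y \<in> T"
proof -
  have "(1/2) *\<^sub>R x + (1/2) *\<^sub>R y \<in> T"
    using assms unfolding open_cone_def convex_def by auto
  then have "2 *\<^sub>R ((1/2) *\<^sub>R x + (1/2) *\<^sub>R y) \<in> T"
    using assms(1) open_cone_scale by fastforce
  then show ?thesis by (simp add: scaleR_add_right)
qed

text \<open>A point \<open>x'\<close> of the cone close to \<open>x\<close> leaves
  \<open>y + x - x'\<close> in the cone by openness, and elements of the cone can be added. This is
  how a weak inequality combined with a strict one becomes strict.\<close>

lemma closure_add_open_cone:
  assumes "open_cone T" "x \<in> closure T" "y \<in> T"
  shows "x + y \<in> T"
proof -
  obtain e where e: "e > 0" "ball y e \<subseteq> T"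
    using assms open_cone_open open_contains_ball by blast
  obtain x' where x': "x' \<in> T" "dist x' x < e"
    using assms(2) e(1) closure_approachable by blast
  have "dist y (y + x - x') < e"
    using x'(2) by (simp add: dist_norm algebra_simps)
  then have "y + x - x' \<in> T" using e by auto
  from open_cone_add[OF assms(1) x'(1) this] show ?thesis by (simp add: algebra_simps)
qed

lemma closure_cone_zero:
  assumes "open_cone T"
  shows "0 \<in> closure T"
proof -
  obtain x where x: "x \<in> T" using assms unfolding open_cone_def by blast
  have "(\<lambda>n. inverse (real (Suc n)) *\<^sub>R x) \<longlonglongrightarrow> 0 *\<^sub>R x"
    by (intro tendsto_intros LIMSEQ_inverse_real_of_nat)
  moreover have "\<And>n. inverse (real (Suc n)) *\<^sub>R x \<in> T"
    using open_cone_scale[OF assms x] by simp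
  ultimately show ?thesis unfolding closure_sequential by force
qed

lemma closure_cone_scale:
  assumes "open_cone T" "x \<in> closure T" "c \<ge> 0"
  shows "c *\<^sub>R x \<in> closure T"
proof (cases "c = 0")
  case True
  then show ?thesis using closure_cone_zero[OF assms(1)] by simp
next
  case False
  then have "(*\<^sub>R) c ` T \<subseteq> T" using open_cone_scale[OF assms(1)] assms(3) by auto
  then have "(*\<^sub>R) c ` closure T \<subseteq> closure T"
    by (metis closure_mono closure_scaleR)
  then show ?thesis using assms(2) by blast
qed

lemma closure_cone_add:
  assumes "open_cone T" "x \<in> closure T" "y \<in> closure T"
  shows "x + y \<in> closure T"
proof -
  obtain Y where Y: "\<And>n. Y n \<in> T" "Y \<longlonglongrightarrow> y"
    using assms(3) unfolding closure_sequential by blast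
  have "(\<lambda>n. x + Y n) \<longlonglongrightarrow> x + y" by (intro tendsto_intros Y)
  moreover have "\<And>n. x + Y n \<in> T" using closure_add_open_cone assms Y by blast
  ultimately show ?thesis unfolding closure_sequential by (intro exI[of _ "\<lambda>n. x + Y n"]) auto
qed

lemma uminus_notin_closure:
  assumes "open_cone T" "x \<in> T"
  shows "- x \<notin> closure T"
  using closure_add_open_cone[of T "- x" x] assms open_cone_zero by force

lemma zero_class_iff: "v \<in> zero_class T \<longleftrightarrow> v \<in> closure T \<and> - v \<in> closure T"
  unfolding zero_class_def by (force simp: image_iff)

lemma zero_class_mono: "S \<subseteq> T \<Longrightarrow> zero_class S \<subseteq> zero_class T"
  using closure_mono[of S T] by (auto simp: zero_class_iff)

lemma subspace_zero_class:
  assumes "open_cone T"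
  shows "subspace (zero_class T)"
proof (rule subspaceI)
  show "0 \<in> zero_class T" using closure_cone_zero[OF assms] by (simp add: zero_class_iff)
next
  fix x y assume "x \<in> zero_class T" "y \<in> zero_class T"
  then show "x + y \<in> zero_class T"
    using closure_cone_add[OF assms, of x y] closure_cone_add[OF assms, of "-x" "-y"]
    by (simp add: zero_class_iff)
next
  fix x and c :: real assume "x \<in> zero_class T"
  then show "c *\<^sub>R x \<in> zero_class T"
    using closure_cone_scale[OF assms, of x "\<bar>c\<bar>"] closure_cone_scale[OF assms, of "-x" "\<bar>c\<bar>"]
    by (cases "c \<ge> 0") (auto simp: zero_class_iff)
qed

lemma open_cone_add_zero_class:
  assumes "open_cone T" "v \<in> zero_class T" "x \<in> T"
  shows "x + v \<in> T"
  using closure_add_open_cone[OF assms(1), of v x] assms by (simp add: zero_class_iff add.commute)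

text \<open>A lineality vector can be added to any point of \<open>C\<close>, so a nonzero one would
  span a line inside \<open>C\<close>. The no-lines hypothesis enters only through this
  fact.\<close>

lemma pointed_closure:
  assumes "open_cone C" "contains_no_lines C" "v \<in> zero_class C"
  shows "v = 0"
proof (rule ccontr)
  assume "v \<noteq> 0"
  obtain x where "x \<in> C" using assms(1) unfolding open_cone_def by blast
  then have "\<forall>t::real. x + t *\<^sub>R v \<in> C"
    using open_cone_add_zero_class[OF assms(1)] subspace_zero_class[OF assms(1)] assms(3)
    by (simp add: subspace_scale)
  with \<open>v \<noteq> 0\<close> show False using assms(2) unfolding contains_no_lines_def by blast
qed

subsection \<open>The gauge of an open cone\<close>

text \<open>Ensures that the infimum in \<open>Mfun\<close> runs over a nonempty set: for large
  \<open>c\<close> the point \<open>x - y/c\<close> is in a ball around \<open>x\<close>.\<close>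

lemma Mfun_nonempty:
  assumes "open_cone T" "x \<in> T"
  shows "\<exists>c>0. c *\<^sub>R x - y \<in> T"
proof -
  obtain e where e: "e > 0" "ball x e \<subseteq> T"
    using assms open_cone_open open_contains_ball by blast
  define c where "c = (norm y + 1) / e"
  have c: "c > 0" using e by (simp add: c_def add_nonneg_pos)
  have "dist x (x - (1/c) *\<^sub>R y) < e"
    using c e by (simp add: dist_norm c_def field_simps)
  then have "x - (1/c) *\<^sub>R y \<in> T" using e by auto
  then have "c *\<^sub>R (x - (1/c) *\<^sub>R y) \<in> T" using c open_cone_scale[OF assms(1)] by blast
  then show ?thesis using c by (intro exI[of _ c]) (simp add: scaleR_diff_right)
qed

lemma Mfun_bdd: "bdd_below {c. c > 0 \<and> cone_le T y (c *\<^sub>R x)}"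
  by (rule bdd_belowI[of _ 0]) auto

lemma Mfun_nonneg:
  assumes "open_cone T" "x \<in> T"
  shows "0 \<le> Mfun T y x"
proof -
  obtain c where "c > 0" "c *\<^sub>R x - y \<in> T" using Mfun_nonempty[OF assms] by blast
  then have "{c. c > 0 \<and> cone_le T y (c *\<^sub>R x)} \<noteq> {}"
    using closure_subset[of T] by (auto simp: cone_le_def)
  then show ?thesis unfolding Mfun_def by (rule cInf_greatest) auto
qed

text \<open>Together with \<open>Mfun_le_iff\<close> this replaces the infimum in later arguments:
  strict bounds correspond to the open cone, weak ones to its closure. Slack in \<open>c\<close>
  contributes a positive multiple of \<open>x\<close>; conversely, openness lets \<open>c\<close>
  shrink a little.\<close>

lemma Mfun_less_iff:
  assumes "open_cone T" "x \<in> T" "c > 0"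
  shows "Mfun T y x < c \<longleftrightarrow> c *\<^sub>R x - y \<in> T"
proof
  assume "Mfun T y x < c"
  moreover have "{c. c > 0 \<and> cone_le T y (c *\<^sub>R x)} \<noteq> {}"
    using Mfun_nonempty[OF assms(1,2), of y] closure_subset[of T] by (auto simp: cone_le_def)
  ultimately have "\<exists>c'\<in>{c. c > 0 \<and> cone_le T y (c *\<^sub>R x)}. c' < c"
    unfolding Mfun_def by (intro cInf_lessD)
  then obtain c' where c': "c' < c" "c' *\<^sub>R x - y \<in> closure T"
    unfolding cone_le_def by blast
  have "(c' *\<^sub>R x - y) + (c - c') *\<^sub>R x \<in> T"
    using c' by (intro closure_add_open_cone[OF assms(1) c'(2)] open_cone_scale[OF assms(1,2)]) simp
  then show "c *\<^sub>R x - y \<in> T" by (simp add: algebra_simps)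
next
  assume *: "c *\<^sub>R x - y \<in> T"
  have "((\<lambda>t. t *\<^sub>R x - y) \<longlongrightarrow> c *\<^sub>R x - y) (at_left c)"
    by (intro tendsto_intros)
  then have "\<forall>\<^sub>F t in at_left c. t *\<^sub>R x - y \<in> T"
    by (rule topological_tendstoD[OF _ open_cone_open[OF assms(1)] *])
  moreover have "\<forall>\<^sub>F t in at_left c. t \<in> {0<..<c}"
    using assms(3) by (rule eventually_at_left_real)
  ultimately have "\<forall>\<^sub>F t in at_left c. t *\<^sub>R x - y \<in> T \<and> t \<in> {0<..<c}"
    by (rule eventually_conj)
  then obtain t where t: "t *\<^sub>R x - y \<in> T" "t \<in> {0<..<c}"
    using eventually_happens[of _ "at_left c"] trivial_limit_at_left_real by blast
  then have "Mfun T y x \<le> t"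
    unfolding Mfun_def using closure_subset[of T]
    by (intro cInf_lower Mfun_bdd) (auto simp: cone_le_def)
  then show "Mfun T y x < c" using t by auto
qed

lemma Mfun_le_iff:
  assumes "open_cone T" "x \<in> T" "c > 0"
  shows "Mfun T y x \<le> c \<longleftrightarrow> c *\<^sub>R x - y \<in> closure T"
proof
  assume *: "Mfun T y x \<le> c"
  have "(\<lambda>n. (c + inverse (real (Suc n))) *\<^sub>R x - y) \<longlonglongrightarrow> (c + 0) *\<^sub>R x - y"
    by (intro tendsto_intros LIMSEQ_inverse_real_of_nat)
  moreover have "(c + inverse (real (Suc n))) *\<^sub>R x - y \<in> T" for n
    by (subst Mfun_less_iff[OF assms(1,2), symmetric]) 
      (use * assms(3) in \<open>auto simp: add_pos_pos intro: le_less_trans\<close>)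
  ultimately show "c *\<^sub>R x - y \<in> closure T"
    unfolding closure_sequential
    by (intro exI[of _ "\<lambda>n. (c + inverse (real (Suc n))) *\<^sub>R x - y"]) auto
next
  assume "c *\<^sub>R x - y \<in> closure T"
  then show "Mfun T y x \<le> c"
    unfolding Mfun_def using assms(3)
    by (intro cInf_lower Mfun_bdd) (auto simp: cone_le_def)
qed

text \<open>If the gauge were 0, all points \<open>x/n - y\<close> would lie in the closure, and so
  would their limit \<open>- y\<close>. Positivity is what makes \<open>Funk\<close>, a logarithm,
  meaningful.\<close>

lemma Mfun_pos:
  assumes "open_cone T" "x \<in> T" "- y \<notin> closure T"
  shows "0 < Mfun T y x"
proof (rule ccontr)
  assume "\<not> 0 < Mfun T y x"
  then have *: "Mfun T y x \<le> inverse (real (Suc n))" for n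
    by (meson inverse_positive_iff_positive less_le_trans linear not_le of_nat_0_less_iff zero_less_Suc)
  have "inverse (real (Suc n)) *\<^sub>R x - y \<in> closure T" for n
    using * by (subst Mfun_le_iff[OF assms(1,2), symmetric]) auto
  moreover have "(\<lambda>n. inverse (real (Suc n)) *\<^sub>R x - y) \<longlonglongrightarrow> 0 *\<^sub>R x - y"
    by (intro tendsto_intros LIMSEQ_inverse_real_of_nat)
  ultimately have "0 *\<^sub>R x - y \<in> closure T"
    by (rule closed_sequentially[OF closed_closure])
  with assms(3) show False by simp
qed

lemma Mfun_pos_cone:
  assumes "open_cone T" "x \<in> T" "y \<in> T"
  shows "0 < Mfun T y x"
  using Mfun_pos uminus_notin_closure assms by blast

lemma Mfun_closure:
  assumes "open_cone T" "x \<in> T" "y \<in> T"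
  shows "Mfun T y x *\<^sub>R x - y \<in> closure T"
  using Mfun_le_iff[OF assms(1,2) Mfun_pos_cone[OF assms], of y] by simp

text \<open>A strict lower bound is an open condition via the complement of the closure, a strict
  upper bound via \<open>T\<close> itself.\<close>

lemma Mfun_tendsto:
  assumes T: "open_cone T" "x \<in> T" and Y: "Y \<longlonglongrightarrow> y" and X: "X \<longlonglongrightarrow> x"
  shows "(\<lambda>n. Mfun T (Y n) (X n)) \<longlonglongrightarrow> Mfun T y x"
proof (rule order_tendstoI)
  have evX: "\<forall>\<^sub>F n in sequentially. X n \<in> T"
    by (rule topological_tendstoD[OF X open_cone_open[OF T(1)] T(2)])
  have lim: "(\<lambda>n. c *\<^sub>R X n - Y n) \<longlonglongrightarrow> c *\<^sub>R x - y" for c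
    by (intro tendsto_intros X Y)
  {
    fix a assume a: "a < Mfun T y x"
    show "\<forall>\<^sub>F n in sequentially. a < Mfun T (Y n) (X n)"
    proof (cases "a < 0")
      case True
      from evX show ?thesis
        by eventually_elim (use True Mfun_nonneg[OF T(1)] in \<open>force intro: less_le_trans\<close>)
    next
      case False
      obtain c where c: "a < c" "c < Mfun T y x" using a dense by blast
      then have c0: "c > 0" using False by simp
      have "c *\<^sub>R x - y \<in> - closure T" using Mfun_le_iff[OF T c0, of y] c by simp
      from topological_tendstoD[OF lim _ this]
      have "\<forall>\<^sub>F n in sequentially. c *\<^sub>R X n - Y n \<in> - closure T" by auto
      with evX show ?thesis
        by eventually_elim (use c Mfun_le_iff[OF T(1) _ c0] in force)
    qed
  next
    fix a assume a: "Mfun T y x < a"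
    then have a0: "a > 0" using Mfun_nonneg[OF T, of y] by linarith
    have "a *\<^sub>R x - y \<in> T" using Mfun_less_iff[OF T a0, of y] a by simp
    from topological_tendstoD[OF lim open_cone_open[OF T(1)] this] evX
    show "\<forall>\<^sub>F n in sequentially. Mfun T (Y n) (X n) < a"
      by eventually_elim (use Mfun_less_iff[OF T(1) _ a0] in auto)
  }
qed

lemma Mfun_self:
  assumes "open_cone T" "x \<in> T"
  shows "Mfun T x x = 1"
proof (rule antisym)
  show "Mfun T x x \<le> 1"
    using Mfun_le_iff[OF assms, of 1 x] closure_cone_zero[OF assms(1)] by simp
  show "1 \<le> Mfun T x x"
    using Mfun_less_iff[OF assms, of 1 x] open_cone_zero[OF assms(1)] by force
qed

lemma Mfun_scale_left:
  assumes "open_cone T" "x \<in> T" "a > 0"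
  shows "Mfun T (a *\<^sub>R y) x = a * Mfun T y x"
proof -
  have *: "Mfun T (a *\<^sub>R y) x \<le> a * c \<longleftrightarrow> Mfun T y x \<le> c" if "c > 0" for c
  proof -
    have "(a * c) *\<^sub>R x - a *\<^sub>R y = a *\<^sub>R (c *\<^sub>R x - y)" by (simp add: algebra_simps)
    moreover have "a *\<^sub>R (c *\<^sub>R x - y) \<in> closure T \<longleftrightarrow> c *\<^sub>R x - y \<in> closure T"
      using closure_cone_scale[OF assms(1), of "c *\<^sub>R x - y" a]
        closure_cone_scale[OF assms(1), of "a *\<^sub>R (c *\<^sub>R x - y)" "1/a"] assms(3) by auto
    ultimately show ?thesis using Mfun_le_iff[OF assms(1,2)] that assms(3) by simp
  qed
  have n: "0 \<le> Mfun T y x" "0 \<le> Mfun T (a *\<^sub>R y) x" using Mfun_nonneg[OF assms(1,2)] by auto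
  show ?thesis
  \<comment> \<open>The gauge may be 0, where the equivalence \<open>*\<close> does not apply; the
    slack \<open>e\<close> keeps the thresholds positive.\<close>
  proof (rule antisym; rule field_le_epsilon)
    fix e :: real assume e: "e > 0"
    have "Mfun T (a *\<^sub>R y) x \<le> a * (Mfun T y x + e / a)"
      by (subst *) (use e n assms(3) in \<open>auto intro: add_nonneg_pos\<close>)
    then show "Mfun T (a *\<^sub>R y) x \<le> a * Mfun T y x + e" using assms(3) by (simp add: distrib_left)
    have "Mfun T y x \<le> (Mfun T (a *\<^sub>R y) x + e) / a"
      by (subst *[symmetric]) (use e n assms(3) in \<open>auto intro!: add_nonneg_pos divide_pos_pos\<close>)
    then show "a * Mfun T y x \<le> Mfun T (a *\<^sub>R y) x + e" using assms(3) by (simp add: field_simps)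
  qed
qed

lemma Mfun_scale_right:
  assumes "open_cone T" "x \<in> T" "a > 0"
  shows "Mfun T y (a *\<^sub>R x) = Mfun T y x / a"
proof -
  have ax: "a *\<^sub>R x \<in> T" by (rule open_cone_scale[OF assms])
  have *: "Mfun T y (a *\<^sub>R x) \<le> c / a \<longleftrightarrow> Mfun T y x \<le> c" if "c > 0" for c
    using Mfun_le_iff[OF assms(1) ax, of "c/a" y] Mfun_le_iff[OF assms(1,2), of c y] that assms(3)
    by simp
  have n: "0 \<le> Mfun T y x" "0 \<le> Mfun T y (a *\<^sub>R x)" using Mfun_nonneg[OF assms(1)] ax assms(2) by auto
  show ?thesis
  proof (rule antisym; rule field_le_epsilon)
    fix e :: real assume e: "e > 0"
    have "Mfun T y (a *\<^sub>R x) \<le> (Mfun T y x + e * a) / a"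
      by (subst *) (use e n assms(3) in \<open>auto intro: add_nonneg_pos\<close>)
    then show "Mfun T y (a *\<^sub>R x) \<le> Mfun T y x / a + e" using assms(3) by (simp add: field_simps)
    have "Mfun T y x \<le> (Mfun T y (a *\<^sub>R x) + e) * a"
      by (subst *[symmetric]) (use e n assms(3) in \<open>auto intro!: add_nonneg_pos mult_pos_pos\<close>)
    then show "Mfun T y x / a \<le> Mfun T y (a *\<^sub>R x) + e" using assms(3) by (simp add: field_simps)
  qed
qed

lemma Mfun_le_trans_right:
  assumes "open_cone T" "x \<in> T" "x' \<in> T" "x' - x \<in> closure T"
  shows "Mfun T y x' \<le> Mfun T y x"
proof (rule field_le_epsilon)
  fix e :: real assume e: "e > 0"
  define c where "c = Mfun T y x + e"
  have c: "c > 0" "Mfun T y x \<le> c" using e Mfun_nonneg[OF assms(1,2), of y] by (auto simp: c_def)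
  have "(c *\<^sub>R x - y) + c *\<^sub>R (x' - x) \<in> closure T"
    using c Mfun_le_iff[OF assms(1,2)] closure_cone_scale[OF assms(1,4)]
    by (intro closure_cone_add[OF assms(1)]) auto
  then show "Mfun T y x' \<le> Mfun T y x + e"
    using Mfun_le_iff[OF assms(1,3) c(1), of y] by (simp add: c_def algebra_simps)
qed

lemma Mfun_le_trans_left:
  assumes "open_cone T" "x \<in> T" "y' - y \<in> closure T"
  shows "Mfun T y x \<le> Mfun T y' x"
proof (rule field_le_epsilon)
  fix e :: real assume e: "e > 0"
  define c where "c = Mfun T y' x + e"
  have c: "c > 0" "Mfun T y' x \<le> c" using e Mfun_nonneg[OF assms(1,2), of y'] by (auto simp: c_def)
  have "(c *\<^sub>R x - y') + (y' - y) \<in> closure T"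
    using c Mfun_le_iff[OF assms(1,2)] assms(3)
    by (intro closure_cone_add[OF assms(1)]) auto
  then show "Mfun T y x \<le> Mfun T y' x + e"
    using Mfun_le_iff[OF assms(1,2) c(1), of y] by (simp add: c_def algebra_simps)
qed

lemma Mfun_triangle:
  assumes "open_cone T" "x \<in> T" "y \<in> T" "z \<in> T"
  shows "Mfun T x z \<le> Mfun T x y * Mfun T y z"
proof -
  have "Mfun T x z \<le> Mfun T (Mfun T x y *\<^sub>R y) z"
    by (intro Mfun_le_trans_left Mfun_closure assms)
  also have "\<dots> = Mfun T x y * Mfun T y z"
    by (intro Mfun_scale_left Mfun_pos_cone assms)
  finally show ?thesis .
qed

lemma Mfun_antimono:
  assumes "open_cone S" "open_cone T" "S \<subseteq> T" "x \<in> S"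
  shows "Mfun T y x \<le> Mfun S y x"
proof (rule field_le_epsilon)
  fix e :: real assume e: "e > 0"
  have c: "Mfun S y x + e > 0" using e Mfun_nonneg[OF assms(1,4), of y] by auto
  have "(Mfun S y x + e) *\<^sub>R x - y \<in> S"
    using Mfun_less_iff[OF assms(1,4) c, of y] e by simp
  then show "Mfun T y x \<le> Mfun S y x + e"
    using Mfun_less_iff[OF assms(2) _ c, of x y] assms(3,4) by (meson less_imp_le subsetD)
qed

text \<open>In the preorder of \<open>T\<close> a lineality vector lies both above and below 0. This
  allows points to be replaced by other representatives modulo the lineality space.\<close>

lemma Mfun_zero_class_right:
  assumes "open_cone T" "x \<in> T" "v \<in> zero_class T"
  shows "Mfun T y (x + v) = Mfun T y x"
proof (rule antisym)
  show "Mfun T y (x + v) \<le> Mfun T y x" "Mfun T y x \<le> Mfun T y (x + v)"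
    using assms open_cone_add_zero_class[OF assms(1,3,2)]
    by (auto intro!: Mfun_le_trans_right simp: zero_class_iff)
qed

lemma Mfun_zero_class_left:
  assumes "open_cone T" "x \<in> T" "v \<in> zero_class T"
  shows "Mfun T (y + v) x = Mfun T y x"
proof (rule antisym)
  show "Mfun T (y + v) x \<le> Mfun T y x" "Mfun T y x \<le> Mfun T (y + v) x"
    using assms by (auto intro!: Mfun_le_trans_left simp: zero_class_iff)
qed

subsection \<open>Iterated tangent cones\<close>

text \<open>Absorbing the factor into the cone presents \<open>tangent_cone T z\<close> as the union
  of the translates \<open>T - s z\<close> with \<open>s > 0\<close>.\<close>

lemma tangent_cone_iff:
  assumes "open_cone T"
  shows "q \<in> tangent_cone T z \<longleftrightarrow> (\<exists>s>0. q + s *\<^sub>R z \<in> T)"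
proof
  assume "q \<in> tangent_cone T z"
  then obtain c y where "c > 0" "y \<in> T" "q = c *\<^sub>R (y - z)" unfolding tangent_cone_def by blast
  then show "\<exists>s>0. q + s *\<^sub>R z \<in> T"
    using open_cone_scale[OF assms] by (intro exI[of _ c]) (simp add: algebra_simps)
next
  assume "\<exists>s>0. q + s *\<^sub>R z \<in> T"
  then obtain s where s: "s > 0" "q + s *\<^sub>R z \<in> T" by blast
  then have "(1/s) *\<^sub>R (q + s *\<^sub>R z) \<in> T" using open_cone_scale[OF assms] by simp
  moreover have "q = s *\<^sub>R ((1/s) *\<^sub>R (q + s *\<^sub>R z) - z)" using s by (simp add: algebra_simps)
  ultimately show "q \<in> tangent_cone T z" unfolding tangent_cone_def using s(1) by blast
qed

text \<open>The translates \<open>T - s z\<close> increase with \<open>s\<close> because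
  \<open>z\<close> is in the closure, so a common \<open>s\<close> serves finitely many
  points.\<close>

lemma tangent_cone_absorb:
  assumes "open_cone T" "z \<in> closure T" "q + s *\<^sub>R z \<in> T" "s \<le> t"
  shows "q + t *\<^sub>R z \<in> T"
proof -
  have "(t - s) *\<^sub>R z + (q + s *\<^sub>R z) \<in> T"
    by (intro closure_add_open_cone closure_cone_scale assms) (use assms in auto)
  then show ?thesis by (simp add: algebra_simps)
qed

lemma frontier_open_cone:
  assumes "open_cone T"
  shows "z \<in> frontier T \<longleftrightarrow> z \<in> closure T \<and> z \<notin> T"
  using open_cone_open[OF assms] by (simp add: frontier_def interior_open)

lemma subset_tangent_cone:
  assumes "open_cone T" "z \<in> frontier T"
  shows "T \<subseteq> tangent_cone T z"
proof
  fix q assume "q \<in> T"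
  then have "z + q \<in> T" using assms closure_add_open_cone frontier_open_cone by blast
  then show "q \<in> tangent_cone T z"
    unfolding tangent_cone_iff[OF assms(1)] by (intro exI[of _ 1]) (simp add: add.commute)
qed

lemma open_cone_tangent_cone:
  assumes T: "open_cone T" and z: "z \<in> frontier T"
  shows "open_cone (tangent_cone T z)"
proof -
  note iff = tangent_cone_iff[OF T] and abs = tangent_cone_absorb[OF T]
  have zc: "z \<in> closure T" "z \<notin> T" using z frontier_open_cone[OF T] by auto
  have "tangent_cone T z \<noteq> {}"
    using subset_tangent_cone[OF T z] T unfolding open_cone_def by blast
  moreover have "open (tangent_cone T z)"
  proof -
    have "tangent_cone T z = (\<Union>s\<in>{0<..}. (+) (- (s *\<^sub>R z)) ` T)"
    proof (intro set_eqI iffI)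
      fix q assume "q \<in> tangent_cone T z"
      then obtain s where "s > 0" "q + s *\<^sub>R z \<in> T" using iff by blast
      then show "q \<in> (\<Union>s\<in>{0<..}. (+) (- (s *\<^sub>R z)) ` T)"
        by (intro UN_I[of s] image_eqI[of _ _ "q + s *\<^sub>R z"]) auto
    qed (use iff in force)
    also have "open \<dots>"
      by (intro open_UN ballI open_translation open_cone_open[OF T])
    finally show ?thesis .
  qed
  moreover have cone: "c *\<^sub>R q \<in> tangent_cone T z" if q: "q \<in> tangent_cone T z" and c: "c > 0" for c q
  proof -
    obtain s where s: "s > 0" "q + s *\<^sub>R z \<in> T" using iff q by blast
    then have "c *\<^sub>R (q + s *\<^sub>R z) \<in> T" using open_cone_scale[OF T] c by blast
    then show ?thesis unfolding iff using s c
      by (intro exI[of _ "c * s"]) (simp add: algebra_simps)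
  qed
  moreover have "convex (tangent_cone T z)"
  proof (rule convexI)
    fix q r and a b :: real
    assume qr: "q \<in> tangent_cone T z" "r \<in> tangent_cone T z" and ab: "0 \<le> a" "0 \<le> b" "a + b = 1"
    obtain s t where st: "s > 0" "q + s *\<^sub>R z \<in> T" "t > 0" "r + t *\<^sub>R z \<in> T" using iff qr by meson
    have "a *\<^sub>R (q + (s+t) *\<^sub>R z) + b *\<^sub>R (r + (s+t) *\<^sub>R z) \<in> T"
      using T ab st abs[OF zc(1) st(2), of "s+t"] abs[OF zc(1) st(4), of "s+t"]
      unfolding open_cone_def convex_def by auto
    moreover have "a *\<^sub>R (q + (s+t) *\<^sub>R z) + b *\<^sub>R (r + (s+t) *\<^sub>R z)
        = (a *\<^sub>R q + b *\<^sub>R r) + ((a + b) * (s+t)) *\<^sub>R z"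
      by (simp add: algebra_simps)
    ultimately show "a *\<^sub>R q + b *\<^sub>R r \<in> tangent_cone T z"
      unfolding iff using ab st by (intro exI[of _ "s+t"]) auto
  qed
  moreover have "0 \<notin> tangent_cone T z"
  proof
    assume "0 \<in> tangent_cone T z"
    then obtain s where s: "s > 0" "s *\<^sub>R z \<in> T" using iff by auto
    then have "(1/s) *\<^sub>R (s *\<^sub>R z) \<in> T" using s by (intro open_cone_scale[OF T s(2)]) simp
    also have "(1/s) *\<^sub>R (s *\<^sub>R z) = z" using s(1) by simp
    finally show False using zc(2) by simp
  qed
  ultimately show ?thesis unfolding open_cone_def by auto
qed

text \<open>The points \<open>x/n - z\<close> lie in the tangent cone and tend to
  \<open>- z\<close>. Thus each passage to a tangent cone puts its direction into the lineality
  space.\<close>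

lemma zero_class_tangent_cone:
  assumes T: "open_cone T" and z: "z \<in> frontier T"
  shows "z \<in> zero_class (tangent_cone T z)"
proof -
  have sub: "T \<subseteq> tangent_cone T z" by (rule subset_tangent_cone[OF assms])
  obtain x where x: "x \<in> T" using T unfolding open_cone_def by blast
  have "inverse (real (Suc n)) *\<^sub>R x - z \<in> tangent_cone T z" for n
    unfolding tangent_cone_iff[OF T] using open_cone_scale[OF T x]
    by (intro exI[of _ 1]) auto
  moreover have "(\<lambda>n. inverse (real (Suc n)) *\<^sub>R x - z) \<longlonglongrightarrow> 0 *\<^sub>R x - z"
    by (intro tendsto_intros LIMSEQ_inverse_real_of_nat)
  ultimately have "- z \<in> closure (tangent_cone T z)"
    unfolding closure_sequential
    by (intro exI[of _ "\<lambda>n. inverse (real (Suc n)) *\<^sub>R x - z"]) auto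
  moreover have "z \<in> closure (tangent_cone T z)"
    using z sub closure_mono frontier_open_cone[OF T] by blast
  ultimately show ?thesis by (simp add: zero_class_iff)
qed

lemma tangent_cone_zero:
  assumes "open_cone T"
  shows "tangent_cone T 0 = T"
proof (rule set_eqI)
  show "q \<in> tangent_cone T 0 \<longleftrightarrow> q \<in> T" for q
    using tangent_cone_iff[OF assms, of q 0] gt_ex[of "0::real"] by simp
qed

text \<open>The union defining \<open>iter_tangent_cones\<close> starts at one application of
  \<open>Gamma\<close>; the cone itself reappears as its tangent cone at the frontier point
  0.\<close>

lemma iter_tangent_cones_refl:
  assumes "open_cone T"
  shows "T \<in> iter_tangent_cones T"
proof -
  have "0 \<in> frontier T"
    using frontier_open_cone[OF assms] closure_cone_zero[OF assms] open_cone_zero[OF assms] by blast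
  then have "T \<in> (Gamma ^^ 1) {T}"
    unfolding Gamma_def using tangent_cone_zero[OF assms] by auto
  then show ?thesis unfolding iter_tangent_cones_def by blast
qed

lemma Gamma_pow_mono: "A \<subseteq> B \<Longrightarrow> (Gamma ^^ k) A \<subseteq> (Gamma ^^ k) B"
  by (induction k) (auto simp: Gamma_def)

text \<open>Peels off the first tangent cone, whereas unfolding \<open>Gamma ^^ Suc k\<close>
  exposes the last one; this suits a recursion on the starting cone.\<close>

lemma iter_tangent_cones_step:
  assumes "z \<in> frontier T" "T' \<in> iter_tangent_cones (tangent_cone T z)"
  shows "T' \<in> iter_tangent_cones T"
proof -
  obtain k where k: "T' \<in> (Gamma ^^ k) {tangent_cone T z}"
    using assms(2) unfolding iter_tangent_cones_def by blast
  have "{tangent_cone T z} \<subseteq> Gamma {T}" using assms(1) unfolding Gamma_def by blast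
  from Gamma_pow_mono[OF this] k have "T' \<in> (Gamma ^^ Suc k) {T}"
    by (simp add: funpow_swap1) blast
  then show ?thesis unfolding iter_tangent_cones_def by force
qed

lemma iter_tangent_cones_induct [consumes 1, case_names base step]:
  assumes "T' \<in> iter_tangent_cones T"
    and "P T"
    and "\<And>S z. P S \<Longrightarrow> z \<in> frontier S \<Longrightarrow> P (tangent_cone S z)"
  shows "P T'"
proof -
  have "\<forall>S\<in>(Gamma ^^ k) {T}. P S" for k
    by (induction k) (use assms in \<open>auto simp: Gamma_def\<close>)
  then show ?thesis using assms(1) unfolding iter_tangent_cones_def by blast
qed

lemma iter_tangent_cones_open_cone:
  assumes "open_cone S" "T \<in> iter_tangent_cones S"
  shows "open_cone T \<and> S \<subseteq> T"
  using assms(2)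
proof (induction rule: iter_tangent_cones_induct)
  case base
  then show ?case using assms(1) by blast
next
  case (step U y)
  then show ?case using open_cone_tangent_cone subset_tangent_cone by blast
qed

subsection \<open>Limits of increasing sequences\<close>

text \<open>If \<open>c n\<close> did not exceed \<open>B\<close>, the relation
  \<open>x \<le> c n zs n\<close> would give \<open>x/B \<le> zs n\<close>. Were this so infinitely
  often, the limit \<open>z\<close> would dominate \<open>x/B\<close> and hence lie in
  \<open>T\<close>.\<close>

lemma scaling_unbounded:
  assumes T: "open_cone T" and z: "z \<in> frontier T" and x: "x \<in> T"
    and cz: "\<And>n. c n *\<^sub>R zs n - x \<in> closure T" and c: "\<And>n. c n > 0"
    and lim: "zs \<longlonglongrightarrow> z" and B: "B > 0"
  shows "\<forall>\<^sub>F n in sequentially. B < c n"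
proof -
  have "z - (1/B) *\<^sub>R x \<notin> closure T"
  proof
    assume "z - (1/B) *\<^sub>R x \<in> closure T"
    then have "(z - (1/B) *\<^sub>R x) + (1/B) *\<^sub>R x \<in> T"
      using B by (intro closure_add_open_cone[OF T] open_cone_scale[OF T x]) auto
    then show False using z frontier_open_cone[OF T] by simp
  qed
  then have mem: "z - (1/B) *\<^sub>R x \<in> - closure T" by simp
  have "(\<lambda>n. zs n - (1/B) *\<^sub>R x) \<longlonglongrightarrow> z - (1/B) *\<^sub>R x" by (intro tendsto_intros lim)
  from topological_tendstoD[OF this _ mem]
  have "\<forall>\<^sub>F n in sequentially. zs n - (1/B) *\<^sub>R x \<in> - closure T" by auto
  then show ?thesis
  proof eventually_elim
    case (elim n)
    show ?case
    proof (rule ccontr)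
      assume "\<not> B < c n"
      then have *: "0 \<le> 1 / c n - 1 / B" using c[of n] B by (simp add: frac_le)
      have "(1 / c n) *\<^sub>R (c n *\<^sub>R zs n - x) + (1 / c n - 1 / B) *\<^sub>R x \<in> closure T"
        using * c[of n] x closure_subset[of T]
        by (intro closure_cone_add[OF T] closure_cone_scale[OF T] cz) auto
      moreover have "(1 / c n) *\<^sub>R (c n *\<^sub>R zs n - x) + (1 / c n - 1 / B) *\<^sub>R x = zs n - (1/B) *\<^sub>R x"
        using c[of n] by (simp add: algebra_simps)
      ultimately show False using elim by simp
    qed
  qed
qed

text \<open>If \<open>q + s z \<in> T\<close> then also \<open>q + s z' \<in> T\<close> for \<open>z'\<close> close to \<open>z\<close>, and \<open>s z'\<close> is
  a negligible multiple of \<open>u n = c n z'\<close> because \<open>c n\<close> tends to infinity.  Thus an order relation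
  in the tangent cone turns into one in \<open>T\<close>, up to an arbitrarily small factor.\<close>

lemma Mfun_tangent_cone_limit:
  assumes T: "open_cone T" and z: "z \<in> frontier T" and u: "\<And>n. u n \<in> T"
    and incr: "\<And>m n. m \<le> n \<Longrightarrow> u n - u m \<in> closure T"
    and uc: "\<And>n. u n = c n *\<^sub>R zs n" and c: "\<And>n. c n > 0" and zs: "zs \<longlonglongrightarrow> z"
    and lim: "(\<lambda>n. Mfun (tangent_cone T z) y (u n)) \<longlonglongrightarrow> l"
  shows "(\<lambda>n. Mfun T y (u n)) \<longlonglongrightarrow> l"
proof (rule order_tendstoI)
  let ?S = "tangent_cone T z"
  have S: "open_cone ?S" by (rule open_cone_tangent_cone[OF T z])
  have TS: "T \<subseteq> ?S" by (rule subset_tangent_cone[OF T z])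
  {
    fix a assume "a < l"
    from order_tendstoD(1)[OF lim this] show "\<forall>\<^sub>F n in sequentially. a < Mfun T y (u n)"
      by eventually_elim (use Mfun_antimono[OF T S TS u, of y] in \<open>blast intro: less_le_trans\<close>)
  next
    fix a assume "l < a"
    then obtain d where d: "l < d" "d < a" using dense by blast
    have "l \<ge> 0"
      using lim by (rule LIMSEQ_le_const) (use Mfun_nonneg[OF S] TS u in blast)
    then have d0: "d > 0" using d by simp
    from order_tendstoD(2)[OF lim d(1)] obtain m where "Mfun ?S y (u m) < d"
      unfolding eventually_sequentially by blast
    then have "d *\<^sub>R u m - y \<in> ?S" using Mfun_less_iff[OF S _ d0] TS u by blast
    then obtain s where s: "s > 0" "d *\<^sub>R u m - y + s *\<^sub>R z \<in> T"
      using tangent_cone_iff[OF T] by blast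
    have "(\<lambda>n. d *\<^sub>R u m - y + s *\<^sub>R zs n) \<longlonglongrightarrow> d *\<^sub>R u m - y + s *\<^sub>R z"
      by (intro tendsto_intros zs)
    from topological_tendstoD[OF this open_cone_open[OF T] s(2)]
    have ev1: "\<forall>\<^sub>F n in sequentially. d *\<^sub>R u m - y + s *\<^sub>R zs n \<in> T" .
    \<comment> \<open>All \<open>u n\<close> dominate \<open>u 0\<close>, so the scaling lemma
      applies; this threshold makes \<open>(a - d) c n\<close> exceed \<open>s\<close>.\<close>
    have ev2: "\<forall>\<^sub>F n in sequentially. s / (a - d) < c n"
      by (rule scaling_unbounded[OF T z u[of 0] _ c zs])
        (use incr[of 0] uc s d in auto)
    show "\<forall>\<^sub>F n in sequentially. Mfun T y (u n) < a"
      using ev1 ev2 eventually_ge_at_top[of m]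
    proof eventually_elim
      case (elim n)
      have "s / (a - d) * (a - d) \<le> c n * (a - d)"
        using elim(2) d by (intro mult_right_mono) auto
      then have pos: "0 \<le> (a - d) * c n - s" using d by (simp add: mult.commute)
      have "zs n = (1 / c n) *\<^sub>R u n" using uc[of n] c[of n] by simp
      then have zc: "zs n \<in> closure T"
        using open_cone_scale[OF T u, of "1 / c n" n] c[of n] closure_subset[of T] by auto
      \<comment> \<open>The part \<open>(a - d) u n\<close> of \<open>a u n\<close> is
        \<open>(a - d) c n\<close> times \<open>zs n\<close>: it pays for \<open>s zs n\<close>, and
        the surplus stays in the closure, as does the growth from \<open>u m\<close> to
        \<open>u n\<close>.\<close>
      have "d *\<^sub>R (u n - u m) + ((a - d) * c n - s) *\<^sub>R zs n \<in> closure T"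
        using elim pos d0 incr zc
        by (intro closure_cone_add[OF T] closure_cone_scale[OF T]) auto
      from closure_add_open_cone[OF T this elim(1)]
      have "(d *\<^sub>R (u n - u m) + ((a - d) * c n - s) *\<^sub>R zs n) + (d *\<^sub>R u m - y + s *\<^sub>R zs n) \<in> T" .
      moreover have "(d *\<^sub>R (u n - u m) + ((a - d) * c n - s) *\<^sub>R zs n) + (d *\<^sub>R u m - y + s *\<^sub>R zs n)
          = d *\<^sub>R u n + (a - d) *\<^sub>R (c n *\<^sub>R zs n) - y"
        by (simp add: algebra_simps)
      moreover have "\<dots> = a *\<^sub>R u n - y" unfolding uc[symmetric] by (simp add: algebra_simps)
      ultimately have "a *\<^sub>R u n - y \<in> T" by simp
      then show ?case using Mfun_less_iff[OF T u] d d0 by simp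
    qed
  }
qed

lemma Mfun_decseq_convergent:
  assumes T: "open_cone T" and u: "\<And>n. u n \<in> T"
    and incr: "\<And>m n. m \<le> n \<Longrightarrow> u n - u m \<in> closure T"
  shows "\<exists>l. (\<lambda>n. Mfun T y (u n)) \<longlonglongrightarrow> l \<and> (\<forall>n. l \<le> Mfun T y (u n))"
proof -
  have "decseq (\<lambda>n. Mfun T y (u n))"
    unfolding decseq_def using Mfun_le_trans_right[OF T u u incr] by blast
  moreover have "\<forall>n. 0 \<le> Mfun T y (u n)" using Mfun_nonneg[OF T u] by blast
  ultimately show ?thesis using decseq_convergent by metis
qed

text \<open>Enlarging a cone can lower gauges, so the bound does not pass over directly. However,
  both cones give the same limit, and the gauges of the tangent cone decrease towards it.\<close>

lemma Mfun_tangent_cone_lower_bound: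
  assumes T: "open_cone T" and z: "z \<in> frontier T" and u: "\<And>n. u n \<in> T"
    and incr: "\<And>m n. m \<le> n \<Longrightarrow> u n - u m \<in> closure T"
    and uc: "\<And>n. u n = c n *\<^sub>R zs n" and c: "\<And>n. c n > 0" and zs: "zs \<longlonglongrightarrow> z"
    and \<delta>: "\<And>n. \<delta> \<le> Mfun T w (u n)"
  shows "\<delta> \<le> Mfun (tangent_cone T z) w (u n)"
proof -
  have S: "open_cone (tangent_cone T z)" by (rule open_cone_tangent_cone[OF T z])
  have TS: "T \<subseteq> tangent_cone T z" by (rule subset_tangent_cone[OF T z])
  have uS: "\<And>n. u n \<in> tangent_cone T z" using u TS by blast
  have incrS: "\<And>m n. m \<le> n \<Longrightarrow> u n - u m \<in> closure (tangent_cone T z)"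
    using incr closure_mono[OF TS] by blast
  from Mfun_decseq_convergent[where u=u and y=w, OF S uS incrS]
  obtain l where l: "(\<lambda>n. Mfun (tangent_cone T z) w (u n)) \<longlonglongrightarrow> l"
      "\<forall>n. l \<le> Mfun (tangent_cone T z) w (u n)"
    by blast
  have "(\<lambda>n. Mfun T w (u n)) \<longlonglongrightarrow> l"
    by (rule Mfun_tangent_cone_limit[OF T z u incr uc c zs l(1)])
  then have "\<delta> \<le> l" by (rule LIMSEQ_le_const) (use \<delta> in blast)
  then show ?thesis using l(2) order_trans by blast
qed

lemma norm_one_convergent_subsequence:
  fixes f :: "nat \<Rightarrow> 'a::euclidean_space"
  assumes "\<And>n. norm (f n) = 1"
  obtains z r where "norm z = 1" "strict_mono r" "(\<lambda>n. f (r n)) \<longlonglongrightarrow> z"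
proof -
  have "seq_compact (sphere (0::'a) 1)"
    by (intro compact_imp_seq_compact compact_sphere)
  moreover have "\<forall>n. f n \<in> sphere 0 1" using assms by simp
  ultimately obtain z r where "z \<in> sphere 0 1" "strict_mono r" "(f \<circ> r) \<longlonglongrightarrow> z"
    by (rule seq_compactE)
  then show ?thesis using that[of z r] by (simp add: o_def)
qed

text \<open>Modulo the lineality space of \<open>T\<close>, either the sequence converges in \<open>T\<close>, or it escapes in a
  direction \<open>z\<close>; passing to the tangent cone at \<open>z\<close> then enlarges the lineality space.\<close>

lemma increasing_sequence_limit:
  fixes T :: "'a::euclidean_space set" and u :: "nat \<Rightarrow> 'a"
  assumes "open_cone T" and "\<And>n. u n \<in> T"
    and "\<And>m n. m \<le> n \<Longrightarrow> u n - u m \<in> closure T"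
    and "w \<in> T" and "\<delta> > 0" and "\<And>n. \<delta> \<le> Mfun T w (u n)"
  shows "\<exists>T'\<in>iter_tangent_cones T. \<exists>p\<in>T'. \<exists>r. strict_mono r \<and>
    (\<forall>y\<in>T. (\<lambda>n. Mfun T y (u (r n))) \<longlonglongrightarrow> Mfun T' y p)"
  using assms
proof (induction "DIM('a) - dim (zero_class T)" arbitrary: T u rule: less_induct)
  case (less T u)
  note T = less.prems(1)
  let ?L = "zero_class T"
  note L = subspace_zero_class[OF T]
  \<comment> \<open>The representative orthogonal to the lineality space has the same gauges, and it
    forces any limiting direction to lie outside that space.\<close>
  have "\<exists>v. v - u n \<in> ?L \<and> (\<forall>x\<in>?L. orthogonal x v)" for n
  proof -
    obtain a v where "a \<in> span ?L" "\<And>x. x \<in> span ?L \<Longrightarrow> orthogonal v x" "u n = a + v"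
      using orthogonal_subspace_decomp_exists[of ?L "u n"] by metis
    then show ?thesis
      using L by (intro exI[of _ v]) (auto simp: orthogonal_commute subspace_neg span_eq_iff[THEN iffD2, OF L])
  qed
  then obtain v where v: "\<And>n. v n - u n \<in> ?L" "\<And>n x. x \<in> ?L \<Longrightarrow> orthogonal x (v n)"
    by metis
  have vT: "v n \<in> T" for n
    using open_cone_add_zero_class[OF T v(1)[of n] less.prems(2)[of n]] by simp
  have Mv: "Mfun T y (v n) = Mfun T y (u n)" for y n
    using Mfun_zero_class_right[OF T less.prems(2)[of n] v(1)[of n], of y] by simp
  have vincr: "v n - v m \<in> closure T" if "m \<le> n" for m n
  proof -
    have "(u n - u m) + ((v n - u n) + - (v m - u m)) \<in> closure T"
      using v(1)[of m] v(1)[of n] less.prems(3)[OF that]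
      by (intro closure_cone_add[OF T]) (auto simp: zero_class_iff)
    then show ?thesis by (simp add: algebra_simps)
  qed
  have vn: "norm (v n) > 0" for n using vT[of n] open_cone_zero[OF T] by auto
  define zs where "zs n = (1 / norm (v n)) *\<^sub>R v n" for n
  have vz: "v n = norm (v n) *\<^sub>R zs n" for n using vn[of n] by (simp add: zs_def)
  have zsT: "zs n \<in> T" for n unfolding zs_def using vn by (intro open_cone_scale[OF T vT]) simp
  have zs1: "norm (zs n) = 1" for n using vn[of n] by (simp add: zs_def)
  obtain z r where zr: "norm z = 1" "strict_mono r" and zs: "(\<lambda>n. zs (r n)) \<longlonglongrightarrow> z"
    by (rule norm_one_convergent_subsequence[where f=zs, OF zs1])
  have zcl: "z \<in> closure T"
    by (rule closed_sequentially[OF closed_closure _ zs]) (use zsT closure_subset in blast)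
  have z_orth: "orthogonal x z" if "x \<in> ?L" for x
  proof -
    have "(\<lambda>n. x \<bullet> zs (r n)) \<longlonglongrightarrow> x \<bullet> z" by (intro tendsto_intros zs)
    moreover have "x \<bullet> zs (r n) = 0" for n
      using v(2)[OF that, of "r n"] by (simp add: zs_def orthogonal_def)
    ultimately show ?thesis by (simp add: orthogonal_def LIMSEQ_const_iff)
  qed
  have znL: "z \<notin> ?L" using z_orth[of z] zr(1) by (auto simp: orthogonal_def)
  have rmono: "r m \<le> r n" if "m \<le> n" for m n
    using that zr(2) by (simp add: strict_mono_less_eq)
  show ?case
  proof (cases "z \<in> T")
    case True
    \<comment> \<open>The norms are quotients of gauges of \<open>w\<close>. The bound
      \<open>\<delta>\<close> keeps the limit of the denominators positive, so the norms converge
      along with the directions.\<close>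
    from Mfun_decseq_convergent[where u=v and y=w, OF T vT vincr]
    obtain l where l: "(\<lambda>n. Mfun T w (v n)) \<longlonglongrightarrow> l" by blast
    have "\<delta> \<le> l" using l by (rule LIMSEQ_le_const) (use less.prems(6) Mv in auto)
    then have l0: "l > 0" using \<open>\<delta> > 0\<close> by simp
    have lr: "(\<lambda>n. Mfun T w (v (r n))) \<longlonglongrightarrow> l"
      using LIMSEQ_subseq_LIMSEQ[OF l zr(2)] by (simp add: o_def)
    have "norm (v (r n)) = Mfun T w (zs (r n)) / Mfun T w (v (r n))" for n
    proof -
      have "Mfun T w (v (r n)) = Mfun T w (zs (r n)) / norm (v (r n))"
        by (subst vz) (rule Mfun_scale_right[OF T zsT vn])
      then show ?thesis using Mfun_pos_cone[OF T zsT[of "r n"] less.prems(4)] vn[of "r n"] by simp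
    qed
    moreover have "(\<lambda>n. Mfun T w (zs (r n)) / Mfun T w (v (r n))) \<longlonglongrightarrow> Mfun T w z / l"
      using l0 by (intro tendsto_divide lr Mfun_tendsto[OF T True _ zs] tendsto_const) auto
    ultimately have nv: "(\<lambda>n. norm (v (r n))) \<longlonglongrightarrow> Mfun T w z / l" by simp
    define p where "p = (Mfun T w z / l) *\<^sub>R z"
    have pT: "p \<in> T" unfolding p_def
      using Mfun_pos_cone[OF T True less.prems(4)] l0 by (intro open_cone_scale[OF T True]) simp
    have vp: "(\<lambda>n. v (r n)) \<longlonglongrightarrow> p"
      unfolding p_def using tendsto_scaleR[OF nv zs] vz by simp
    have "(\<lambda>n. Mfun T y (u (r n))) \<longlonglongrightarrow> Mfun T y p" for y
      unfolding Mv[symmetric] by (intro Mfun_tendsto[OF T pT _ vp] tendsto_const)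
    then show ?thesis using iter_tangent_cones_refl[OF T] pT zr(2) by blast
  next
    case False
    then have z: "z \<in> frontier T" using zcl frontier_open_cone[OF T] by blast
    let ?S = "tangent_cone T z"
    have S: "open_cone ?S" by (rule open_cone_tangent_cone[OF T z])
    have TS: "T \<subseteq> ?S" by (rule subset_tangent_cone[OF T z])
    have "?L \<subset> zero_class ?S"
      using zero_class_mono[OF TS] znL zero_class_tangent_cone[OF T z] by blast
    then have "dim ?L < dim (zero_class ?S)"
      by (intro dim_psubset) (simp add: span_eq_iff[THEN iffD2] L subspace_zero_class[OF S])
    then have dimS: "DIM('a) - dim (zero_class ?S) < DIM('a) - dim ?L"
      using dim_subset_UNIV[of "zero_class ?S"] by simp
    have "\<exists>T'\<in>iter_tangent_cones ?S. \<exists>p\<in>T'. \<exists>r'. strict_mono r' \<and>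
        (\<forall>y\<in>?S. (\<lambda>n. Mfun ?S y (v (r (r' n)))) \<longlonglongrightarrow> Mfun T' y p)"
    proof (rule less.hyps[OF dimS S])
      show "v (r n) \<in> ?S" for n using vT TS by blast
      show "v (r n) - v (r m) \<in> closure ?S" if "m \<le> n" for m n
        using vincr[OF rmono[OF that]] closure_mono[OF TS] by blast
      show "w \<in> ?S" using less.prems(4) TS by blast
      show "\<delta> \<le> Mfun ?S w (v (r n))" for n
        by (rule Mfun_tangent_cone_lower_bound[where u="\<lambda>n. v (r n)" and zs="\<lambda>n. zs (r n)"
              and c="\<lambda>n. norm (v (r n))", OF T z vT vincr[OF rmono] vz vn zs])
          (simp_all add: Mv less.prems(6))
    qed fact
    then obtain T' p r' where T': "T' \<in> iter_tangent_cones ?S" "p \<in> T'" and r': "strict_mono r'"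
      and lim: "\<And>y. y \<in> ?S \<Longrightarrow> (\<lambda>n. Mfun ?S y (v (r (r' n)))) \<longlonglongrightarrow> Mfun T' y p"
      by blast
    have zs': "(\<lambda>n. zs (r (r' n))) \<longlonglongrightarrow> z"
      using LIMSEQ_subseq_LIMSEQ[OF zs r'] by (simp add: o_def)
    have r'mono: "r' m \<le> r' n" if "m \<le> n" for m n
      using that r' by (simp add: strict_mono_less_eq)
    \<comment> \<open>The recursion yields a limit of gauges in \<open>?S\<close>, which is carried
      back to gauges in \<open>T\<close>.\<close>
    have "(\<lambda>n. Mfun T y (u (r (r' n)))) \<longlonglongrightarrow> Mfun T' y p" if y: "y \<in> T" for y
    proof -
      have "(\<lambda>n. Mfun T y (v (r (r' n)))) \<longlonglongrightarrow> Mfun T' y p"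
      proof (rule Mfun_tangent_cone_limit[where u="\<lambda>n. v (r (r' n))" and zs="\<lambda>n. zs (r (r' n))"
            and c="\<lambda>n. norm (v (r (r' n)))", OF T z vT vincr vz vn zs' lim])
        show "y \<in> ?S" using y TS by blast
      qed (intro rmono r'mono)
      then show ?thesis by (simp add: Mv)
    qed
    moreover have "strict_mono (\<lambda>n. r (r' n))"
      using strict_mono_o[OF zr(2) r'] by (simp add: o_def)
    ultimately have "strict_mono (\<lambda>n. r (r' n)) \<and>
        (\<forall>y\<in>T. (\<lambda>n. Mfun T y (u (r (r' n)))) \<longlonglongrightarrow> Mfun T' y p)" by blast
    then show ?thesis
      by (intro bexI[OF _ iter_tangent_cones_step[OF z T'(1)]] bexI[OF _ T'(2)]
          exI[of _ "\<lambda>n. r (r' n)"])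
  qed
qed

subsection \<open>Limits of almost-geodesics\<close>

lemma Funk_scale_left:
  assumes "open_cone T" "x \<in> T" "0 < Mfun T y x" "a > 0"
  shows "Funk T (a *\<^sub>R y) x = ln a + Funk T y x"
  unfolding Funk_def using Mfun_scale_left[OF assms(1,2,4)] assms by (simp add: ln_mult)

lemma Funk_scale_right:
  assumes "open_cone T" "x \<in> T" "y \<in> T" "a > 0"
  shows "Funk T y (a *\<^sub>R x) = Funk T y x - ln a"
  unfolding Funk_def using Mfun_scale_right[OF assms(1,2,4)] Mfun_pos_cone[OF assms(1-3)] assms(4)
  by (simp add: ln_div)

lemma Funk_self: "open_cone T \<Longrightarrow> x \<in> T \<Longrightarrow> Funk T x x = 0"
  by (simp add: Funk_def Mfun_self)

lemma Funk_triangle: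
  assumes "open_cone T" "x \<in> T" "y \<in> T" "z \<in> T"
  shows "Funk T x z \<le> Funk T x y + Funk T y z"
proof -
  have pos: "0 < Mfun T x z" "0 < Mfun T x y" "0 < Mfun T y z"
    using assms by (auto intro: Mfun_pos_cone)
  have "ln (Mfun T x z) \<le> ln (Mfun T x y * Mfun T y z)"
    using Mfun_triangle[OF assms] pos by (subst ln_le_cancel_iff) auto
  then show ?thesis unfolding Funk_def using pos by (simp add: ln_mult)
qed

lemma Funk_le_iff:
  assumes "open_cone T" "x \<in> T" "y \<in> T"
  shows "Funk T y x \<le> a \<longleftrightarrow> exp a *\<^sub>R x - y \<in> closure T"
proof -
  have "Funk T y x \<le> a \<longleftrightarrow> Mfun T y x \<le> exp a"
    unfolding Funk_def using Mfun_pos_cone[OF assms] by (metis exp_le_cancel_iff exp_ln)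
  then show ?thesis using Mfun_le_iff[OF assms(1,2)] by simp
qed

lemma Hilbert_nonneg:
  assumes "open_cone T" "x \<in> T" "y \<in> T"
  shows "0 \<le> Hilbert T x y"
  using Funk_triangle[OF assms(1,2,3,2)] Funk_self[OF assms(1,2)] by (simp add: Hilbert_def)

lemma Mfun_frontier_pos:
  assumes "open_cone C" "contains_no_lines C" "z \<in> closure C" "z \<noteq> 0" "x \<in> C"
  shows "0 < Mfun C z x"
  using assms pointed_closure[of C z] by (intro Mfun_pos) (auto simp: zero_class_iff)

text \<open>Subtracting the value at \<open>b\<close> cancels the scaling of \<open>x n\<close>, so
  only its limiting direction matters, and \<open>Mfun\<close> is continuous in its first argument.
  The limit \<open>z\<close> may also be inside \<open>C\<close>.\<close>

lemma Funk_diff_tendsto_r_fun: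
  assumes C: "open_cone C" "contains_no_lines C" "b \<in> C" and y: "y \<in> C"
    and x: "\<And>n. x n \<in> C" and c: "\<And>n. c n > 0"
    and z: "z \<in> closure C" "z \<noteq> 0" and lim: "(\<lambda>n. c n *\<^sub>R x n) \<longlonglongrightarrow> z"
  shows "(\<lambda>n. Funk C (x n) y - Funk C (x n) b) \<longlonglongrightarrow> r_fun b C z y"
proof -
  have *: "(\<lambda>n. Funk C (c n *\<^sub>R x n) q) \<longlonglongrightarrow> Funk C z q" if "q \<in> C" for q
    unfolding Funk_def
    using Mfun_frontier_pos[OF C(1,2) z that]
    by (intro tendsto_ln Mfun_tendsto[OF C(1) that lim] tendsto_const) auto
  have "Funk C (x n) y - Funk C (x n) b = Funk C (c n *\<^sub>R x n) y - Funk C (c n *\<^sub>R x n) b" for n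
    using Funk_scale_left[OF C(1) y Mfun_pos_cone[OF C(1) y x] c]
      Funk_scale_left[OF C(1,3) Mfun_pos_cone[OF C(1,3) x] c] by simp
  then show ?thesis unfolding r_fun_def using tendsto_diff[OF *[OF y] *[OF C(3)]] by simp
qed

lemma Funk_chain:
  fixes x :: "nat \<Rightarrow> 'a::euclidean_space"
  assumes "open_cone C" "\<And>n. x n \<in> C"
  shows "Funk C (x n) (x 0) \<le> (\<Sum>i=1..n. Funk C (x i) (x (i - 1)))"
proof (induction n)
  case 0
  then show ?case using Funk_self[OF assms] by simp
next
  case (Suc n)
  then show ?case using Funk_triangle[OF assms(1), of "x (Suc n)" "x n" "x 0"] assms(2) by simp
qed

text \<open>The Hilbert length is the Funk length plus that of the reversed path, and by
  \<open>Funk_chain\<close> the latter is at least the reversed distance. Dropping it keeps the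
  bound \<open>\<epsilon>\<close>.\<close>

lemma almost_geodesic_Hilbert_imp_Funk:
  assumes "open_cone C" "almost_geodesic C (Hilbert C) x"
  shows "almost_geodesic C (Funk C) x"
proof -
  have x: "x n \<in> C" for n using assms(2) unfolding almost_geodesic_def by blast
  obtain \<epsilon> where e: "\<epsilon> > 0"
    "\<And>l. l \<ge> 1 \<Longrightarrow> (\<Sum>i=1..l. Hilbert C (x (i - 1)) (x i)) \<le> Hilbert C (x 0) (x l) + \<epsilon>"
    using assms(2) unfolding almost_geodesic_def by blast
  have "(\<Sum>i=1..l. Funk C (x (i - 1)) (x i)) \<le> Funk C (x 0) (x l) + \<epsilon>" if "l \<ge> 1" for l
    using e(2)[OF that] Funk_chain[where x=x and n=l, OF assms(1) x] unfolding Hilbert_def by (simp add: sum.distrib)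
  then show ?thesis unfolding almost_geodesic_def using x e(1) by blast
qed

text \<open>Rescaling \<open>x n\<close> by the exponential of the length of the path up to it makes consecutive terms
  have Funk distance 0, so the path becomes increasing.\<close>

lemma Funk_almost_geodesic_rescale:
  assumes C: "open_cone C" and ag: "almost_geodesic C (Funk C) x"
  obtains a \<delta> where "\<And>n. a n > 0" "\<And>m n. m \<le> n \<Longrightarrow> a n *\<^sub>R x n - a m *\<^sub>R x m \<in> closure C"
    "\<delta> > 0" "\<And>n. \<delta> \<le> Mfun C (x 0) (a n *\<^sub>R x n)"
proof -
  have x: "x n \<in> C" for n using ag unfolding almost_geodesic_def by blast
  obtain \<epsilon> where e: "\<epsilon> > 0"
    "\<And>l. l \<ge> 1 \<Longrightarrow> (\<Sum>i=1..l. Funk C (x (i - 1)) (x i)) \<le> Funk C (x 0) (x l) + \<epsilon>"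
    using ag unfolding almost_geodesic_def by blast
  define S where "S n = (\<Sum>i=1..n. Funk C (x (i - 1)) (x i))" for n
  have S: "S n \<le> Funk C (x 0) (x n) + \<epsilon>" for n
    using e(1) e(2)[of n] Funk_self[OF C x] by (cases "n = 0") (simp_all add: S_def)
  have step: "exp (S (Suc n)) *\<^sub>R x (Suc n) - exp (S n) *\<^sub>R x n \<in> closure C" for n
  proof -
    have "exp (Funk C (x n) (x (Suc n))) *\<^sub>R x (Suc n) - x n \<in> closure C"
      using Funk_le_iff[OF C x x] by blast
    from closure_cone_scale[OF C this, of "exp (S n)"] show ?thesis
      by (simp add: S_def exp_add algebra_simps)
  qed
  have incr: "exp (S n) *\<^sub>R x n - exp (S m) *\<^sub>R x m \<in> closure C" if "m \<le> n" for m n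
    using that
  proof (induction n rule: dec_induct)
    case base
    then show ?case using closure_cone_zero[OF C] by simp
  next
    case (step n)
    from closure_cone_add[OF C \<open>\<And>n. exp (S (Suc n)) *\<^sub>R x (Suc n) - exp (S n) *\<^sub>R x n \<in> closure C\<close>[of n] step.IH]
    show ?case by simp
  qed
  \<comment> \<open>The lower bound comes from the almost-geodesic estimate \<open>S\<close>, since
    scaling by \<open>exp (S n)\<close> subtracts \<open>S n\<close> from the Funk value.\<close>
  have "exp (- \<epsilon>) \<le> Mfun C (x 0) (exp (S n) *\<^sub>R x n)" for n
  proof -
    have "- \<epsilon> \<le> Funk C (x 0) (exp (S n) *\<^sub>R x n)"
      using Funk_scale_right[OF C x[of n] x[of 0], of "exp (S n)"] S[of n] by simp
    then show ?thesis
      unfolding Funk_def using Mfun_pos_cone[OF C open_cone_scale[OF C x[of n]] x[of 0], of "exp (S n)"]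
      by (metis exp_gt_zero exp_le_cancel_iff exp_ln)
  qed
  then show ?thesis using incr that[of "\<lambda>n. exp (S n)" "exp (- \<epsilon>)"] by simp
qed

text \<open>The limiting direction \<open>z\<close> produces the reverse Funk part. The forward part
  is analysed in the tangent cone at this same \<open>z\<close> rather than in \<open>C\<close>, so
  that both summands share it.\<close>

lemma Busemann_point_form:
  fixes C :: "'a::euclidean_space set"
  assumes C: "open_cone C" "contains_no_lines C" "b \<in> C"
    and g: "g \<in> Busemann_points C (Hilbert C) b"
  obtains z T p where "z \<in> frontier C - {0}" "T \<in> iter_tangent_cones (tangent_cone C z)" "p \<in> T"
    "g = restrict (\<lambda>x. r_fun b C z x + f_fun b T p x) C"
proof -
  obtain x where ag: "almost_geodesic C (Hilbert C) x" and conv: "converges_d C (Hilbert C) b x g"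
    using g unfolding Busemann_points_def by blast
  have ext: "g \<in> extensional C" and notint: "\<not> (\<exists>p\<in>C. \<forall>y\<in>C. g y = Hilbert C y p - Hilbert C b p)"
    using g unfolding Busemann_points_def by auto
  have x: "x n \<in> C" for n using ag unfolding almost_geodesic_def by blast
  obtain a \<delta> where a: "\<And>n. a n > 0" and incr: "\<And>m n. m \<le> n \<Longrightarrow> a n *\<^sub>R x n - a m *\<^sub>R x m \<in> closure C"
    and \<delta>: "\<delta> > 0" "\<And>n. \<delta> \<le> Mfun C (x 0) (a n *\<^sub>R x n)"
    using Funk_almost_geodesic_rescale[OF C(1) almost_geodesic_Hilbert_imp_Funk[OF C(1) ag]] by blast
  have xn: "norm (x n) > 0" for n using x[of n] open_cone_zero[OF C(1)] by auto
  define zs where "zs n = (1 / norm (x n)) *\<^sub>R x n" for n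
  have zsC: "zs n \<in> C" for n unfolding zs_def using xn by (intro open_cone_scale[OF C(1) x]) simp
  have zs1: "norm (zs n) = 1" for n using xn[of n] by (simp add: zs_def)
  obtain z r where zr: "norm z = 1" "strict_mono r" and zs: "(\<lambda>n. zs (r n)) \<longlonglongrightarrow> z"
    by (rule norm_one_convergent_subsequence[where f=zs, OF zs1])
  have zcl: "z \<in> closure C"
    by (rule closed_sequentially[OF closed_closure _ zs]) (use zsC closure_subset in blast)
  have z0: "z \<noteq> 0" using zr(1) by auto
  have rmono: "r m \<le> r n" if "m \<le> n" for m n
    using that zr(2) by (simp add: strict_mono_less_eq)
  have rlim: "(\<lambda>n. Funk C (x (r n)) y - Funk C (x (r n)) b) \<longlonglongrightarrow> r_fun b C z y" if "y \<in> C" for y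
    by (rule Funk_diff_tendsto_r_fun[OF C that x _ zcl z0, of "\<lambda>n. 1 / norm (x (r n))"])
      (use xn zs in \<open>simp_all add: zs_def\<close>)
  have glim: "(\<lambda>n. Hilbert C y (x (r n)) - Hilbert C b (x (r n))) \<longlonglongrightarrow> g y" if "y \<in> C" for y
  proof -
    have "(\<lambda>n. Hilbert C y (x n) - Hilbert C b (x n)) \<longlonglongrightarrow> g y"
      using conv that unfolding converges_d_def by blast
    from LIMSEQ_subseq_LIMSEQ[OF this zr(2)] show ?thesis by (simp add: o_def)
  qed
  \<comment> \<open>Limits of the Funk parts along any further subsequence determine
    \<open>g\<close>; this serves both the case of \<open>z\<close> in \<open>C\<close> and the
    frontier case.\<close>
  have g_eq: "g y = r_fun b C z y + L y"
    if y: "y \<in> C" and q: "strict_mono q"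
      and L: "(\<lambda>n. Funk C y (x (r (q n))) - Funk C b (x (r (q n)))) \<longlonglongrightarrow> L y" for y L q
  proof (rule LIMSEQ_unique)
    show "(\<lambda>n. Hilbert C y (x (r (q n))) - Hilbert C b (x (r (q n)))) \<longlonglongrightarrow> g y"
      using LIMSEQ_subseq_LIMSEQ[OF glim[OF y] q] by (simp add: o_def)
    have "(\<lambda>n. (Funk C (x (r (q n))) y - Funk C (x (r (q n))) b)
        + (Funk C y (x (r (q n))) - Funk C b (x (r (q n))))) \<longlonglongrightarrow> r_fun b C z y + L y"
      using LIMSEQ_subseq_LIMSEQ[OF rlim[OF y] q] by (intro tendsto_add L) (simp add: o_def)
    then show "(\<lambda>n. Hilbert C y (x (r (q n))) - Hilbert C b (x (r (q n)))) \<longlonglongrightarrow> r_fun b C z y + L y"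
      by (simp add: Hilbert_def algebra_simps)
  qed
  \<comment> \<open>Otherwise \<open>g\<close> would be the normalised distance to \<open>z\<close>,
    which the definition of Busemann points excludes.\<close>
  have "z \<notin> C"
  proof
    assume z: "z \<in> C"
    have F: "(\<lambda>n. Funk C y (zs (r n))) \<longlonglongrightarrow> Funk C y z" if "y \<in> C" for y
      unfolding Funk_def using Mfun_pos_cone[OF C(1) z that]
      by (intro tendsto_ln Mfun_tendsto[OF C(1) z _ zs] tendsto_const) auto
    have "g y = Hilbert C y z - Hilbert C b z" if y: "y \<in> C" for y
    proof -
      have "Funk C y (x n) - Funk C b (x n) = Funk C y (zs n) - Funk C b (zs n)" for n
        unfolding zs_def using Funk_scale_right[OF C(1) x[of n]] C(3) y xn[of n] by simp
      then have "g y = r_fun b C z y + (Funk C y z - Funk C b z)"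
        using g_eq[OF y strict_mono_id, of "\<lambda>y. Funk C y z - Funk C b z"] tendsto_diff[OF F[OF y] F[OF C(3)]] by simp
      then show ?thesis by (simp add: r_fun_def Hilbert_def)
    qed
    then show False using notint z by blast
  qed
  then have z: "z \<in> frontier C" using zcl frontier_open_cone[OF C(1)] by blast
  let ?S = "tangent_cone C z"
  define u where "u n = a n *\<^sub>R x n" for n
  have uC: "u n \<in> C" for n unfolding u_def by (rule open_cone_scale[OF C(1) x a])
  have uincr: "u n - u m \<in> closure C" if "m \<le> n" for m n
    unfolding u_def by (rule incr[OF that])
  have uz: "u n = (a n * norm (x n)) *\<^sub>R zs n" for n using xn[of n] by (simp add: u_def zs_def)
  have S: "open_cone ?S" by (rule open_cone_tangent_cone[OF C(1) z])
  have CS: "C \<subseteq> ?S" by (rule subset_tangent_cone[OF C(1) z])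
  have "\<exists>T'\<in>iter_tangent_cones ?S. \<exists>p\<in>T'. \<exists>r'. strict_mono r' \<and>
      (\<forall>y\<in>?S. (\<lambda>n. Mfun ?S y (u (r (r' n)))) \<longlonglongrightarrow> Mfun T' y p)"
  proof (rule increasing_sequence_limit[OF S])
    show "u (r n) \<in> ?S" for n using uC CS by blast
    show "u (r n) - u (r m) \<in> closure ?S" if "m \<le> n" for m n
      using uincr[OF rmono[OF that]] closure_mono[OF CS] by blast
    show "x 0 \<in> ?S" using x CS by blast
    show "\<delta> > 0" by fact
    show "\<delta> \<le> Mfun ?S (x 0) (u (r n))" for n
    proof (rule Mfun_tangent_cone_lower_bound[where u="\<lambda>n. u (r n)" and zs="\<lambda>n. zs (r n)"
          and c="\<lambda>n. a (r n) * norm (x (r n))", OF C(1) z uC uincr[OF rmono] uz _ zs])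
      show "0 < a (r n) * norm (x (r n))" for n using a xn by simp
      show "\<delta> \<le> Mfun C (x 0) (u (r n))" for n using \<delta>(2) by (simp add: u_def)
    qed
  qed
  then obtain T' p r' where T': "T' \<in> iter_tangent_cones ?S" "p \<in> T'" and r': "strict_mono r'"
    and lim: "\<And>y. y \<in> ?S \<Longrightarrow> (\<lambda>n. Mfun ?S y (u (r (r' n)))) \<longlonglongrightarrow> Mfun T' y p"
    by blast
  have zs': "(\<lambda>n. zs (r (r' n))) \<longlonglongrightarrow> z"
    using LIMSEQ_subseq_LIMSEQ[OF zs r'] by (simp add: o_def)
  have props: "open_cone T' \<and> C \<subseteq> T'"
    using iter_tangent_cones_open_cone[OF S T'(1)] CS by blast
  have F: "(\<lambda>n. Funk C y (u (r (r' n)))) \<longlonglongrightarrow> Funk T' y p" if y: "y \<in> C" for y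
  proof -
    have "(\<lambda>n. Mfun C y (u (r (r' n)))) \<longlonglongrightarrow> Mfun T' y p"
    proof (rule Mfun_tangent_cone_limit[where u="\<lambda>n. u (r (r' n))" and zs="\<lambda>n. zs (r (r' n))"
          and c="\<lambda>n. a (r (r' n)) * norm (x (r (r' n)))", OF C(1) z uC uincr uz _ zs' lim])
      show "y \<in> ?S" using y CS by blast
      show "0 < a (r (r' n)) * norm (x (r (r' n)))" for n using a xn by simp
      show "r (r' m) \<le> r (r' n)" if "m \<le> n" for m n
        using that r' by (intro rmono) (simp add: strict_mono_less_eq)
    qed
    then show ?thesis
      unfolding Funk_def using Mfun_pos_cone[of T' p y] props T'(2) y by (intro tendsto_ln) auto
  qed
  have "g y = r_fun b C z y + f_fun b T' p y" if y: "y \<in> C" for y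
  proof (rule g_eq[OF y r'])
    have "Funk C y (x n) - Funk C b (x n) = Funk C y (u n) - Funk C b (u n)" for n
      unfolding u_def using Funk_scale_right[OF C(1) x[of n]] C(3) y a[of n] by simp
    then show "(\<lambda>n. Funk C y (x (r (r' n))) - Funk C b (x (r (r' n)))) \<longlonglongrightarrow> f_fun b T' p y"
      unfolding f_fun_def using tendsto_diff[OF F[OF y] F[OF C(3)]] by simp
  qed
  then have "g = restrict (\<lambda>x. r_fun b C z x + f_fun b T' p x) C"
    using ext by (intro extensionalityI[of _ C]) auto
  then show ?thesis using that[of z T' p] z z0 T' by blast
qed

subsection \<open>Construction of almost-geodesics\<close>

text \<open>The tangent cone is an increasing union of open translates of \<open>T\<close>, so a
  compact subset lies in a single one.\<close>

lemma compact_subset_tangent_cone: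
  assumes T: "open_cone T" and z: "z \<in> frontier T"
    and K: "compact K" "K \<subseteq> tangent_cone T z"
  obtains s where "s > 0" "\<And>t k. s \<le> t \<Longrightarrow> k \<in> K \<Longrightarrow> k + t *\<^sub>R z \<in> T"
proof -
  have zcl: "z \<in> closure T" using z frontier_open_cone[OF T] by blast
  have op: "open {q. q + s *\<^sub>R z \<in> T}" for s
  proof -
    have "open ((\<lambda>q. q + s *\<^sub>R z) -` T)"
      by (intro open_vimage open_cone_open[OF T] continuous_intros)
    then show ?thesis by (simp add: vimage_def)
  qed
  have "K \<subseteq> (\<Union>s\<in>{0<..}. {q. q + s *\<^sub>R z \<in> T})"
    using K(2) tangent_cone_iff[OF T] by blast
  then obtain S where S: "S \<subseteq> {0<..}" "finite S" "K \<subseteq> (\<Union>s\<in>S. {q. q + s *\<^sub>R z \<in> T})"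
    by (rule compactE_image[where f="\<lambda>s. {q. q + s *\<^sub>R z \<in> T}", OF K(1) op])
  \<comment> \<open>Inserting 1 covers an empty \<open>S\<close> and makes the maximum
    positive.\<close>
  define m where "m = Max (insert 1 S)"
  have m: "1 \<le> m" "\<And>s. s \<in> S \<Longrightarrow> s \<le> m" using S(2) by (auto simp: m_def)
  show ?thesis
  proof (rule that[of m])
    show "m > 0" using m(1) by simp
    fix t k assume "m \<le> t" "k \<in> K"
    moreover then obtain s where "s \<in> S" "k + s *\<^sub>R z \<in> T" using S(3) by blast
    ultimately show "k + t *\<^sub>R z \<in> T"
      using tangent_cone_absorb[OF T zcl] m(2) order_trans by blast
  qed
qed

text \<open>Each tangent cone step pushes the set along a multiple of its direction, a lineality
  vector of the new cone, and these vectors add up. As the set moves at each step, the induction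
  ranges over all compact sets.\<close>

lemma compact_subset_iter_tangent_cone:
  assumes S: "open_cone S" and T: "T \<in> iter_tangent_cones S" and K: "compact K" "K \<subseteq> T"
  shows "\<exists>v\<in>zero_class T. \<forall>k\<in>K. k + v \<in> S"
proof -
  have "open_cone T \<and> (\<forall>K. compact K \<longrightarrow> K \<subseteq> T \<longrightarrow> (\<exists>v\<in>zero_class T. \<forall>k\<in>K. k + v \<in> S))"
    using T
  proof (induction rule: iter_tangent_cones_induct)
    case base
    have "0 \<in> zero_class S" using subspace_0[OF subspace_zero_class[OF S]] .
    then show ?case using S by (auto intro!: bexI[of _ 0])
  next
    case (step U z)
    let ?W = "tangent_cone U z"
    have U: "open_cone U" and z: "z \<in> frontier U" using step by auto
    have IH: "\<exists>v\<in>zero_class U. \<forall>k\<in>K. k + v \<in> S" if "compact K" "K \<subseteq> U" for K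
      using step.IH that by (elim conjE allE[of _ K] impE)
    have W: "open_cone ?W" by (rule open_cone_tangent_cone[OF U z])
    have "\<exists>v\<in>zero_class ?W. \<forall>k\<in>K. k + v \<in> S" if K: "compact K" "K \<subseteq> ?W" for K
    proof -
      obtain s where s: "\<And>t k. s \<le> t \<Longrightarrow> k \<in> K \<Longrightarrow> k + t *\<^sub>R z \<in> U"
        using compact_subset_tangent_cone[OF U z K] by metis
      have "compact ((\<lambda>k. k + s *\<^sub>R z) ` K)"
        by (intro compact_continuous_image continuous_intros K)
      moreover have "(\<lambda>k. k + s *\<^sub>R z) ` K \<subseteq> U" using s by blast
      ultimately have "\<exists>v\<in>zero_class U. \<forall>k\<in>(\<lambda>k. k + s *\<^sub>R z) ` K. k + v \<in> S" by (rule IH)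
      then obtain v where v: "v \<in> zero_class U" "\<forall>k\<in>K. (k + s *\<^sub>R z) + v \<in> S" by auto
      have "s *\<^sub>R z + v \<in> zero_class ?W"
        using v(1) zero_class_mono[OF subset_tangent_cone[OF U z]] zero_class_tangent_cone[OF U z]
          subspace_zero_class[OF W] by (intro subspace_add subspace_scale) auto
      then show ?thesis using v(2) by (intro bexI[of _ "s *\<^sub>R z + v"]) (auto simp: add.assoc)
    qed
    then show ?case using W by blast
  qed
  then show ?thesis using K by blast
qed

text \<open>A lineality vector first moves \<open>K\<close> and \<open>p\<close> into the tangent
  cone at \<open>z\<close>; then a large multiple \<open>s z\<close> moves them into
  \<open>C\<close>. As \<open>s\<close> grows, \<open>p + v\<close> turns towards
  \<open>z\<close>.\<close>

lemma approximating_translation: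
  assumes C: "open_cone C" and z: "z \<in> frontier C" and T: "T \<in> iter_tangent_cones (tangent_cone C z)"
    and p: "p \<in> T" and K: "compact K" "K \<subseteq> T" and \<delta>: "\<delta> > 0" and \<eta>: "\<eta> > 0"
  shows "\<exists>v\<in>zero_class T. \<exists>s>0. (\<forall>k\<in>K. k + v \<in> C) \<and> exp \<delta> *\<^sub>R (p + v) - s *\<^sub>R z \<in> C \<and>
    dist ((1/s) *\<^sub>R (p + v)) z < \<eta>"
proof -
  let ?S = "tangent_cone C z"
  have S: "open_cone ?S" by (rule open_cone_tangent_cone[OF C z])
  have ocT: "open_cone T" "?S \<subseteq> T" using iter_tangent_cones_open_cone[OF S T] by auto
  have zT: "z \<in> zero_class T"
    using zero_class_tangent_cone[OF C z] zero_class_mono[OF ocT(2)] by blast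
  have "compact (insert p K)" "insert p K \<subseteq> T" using K p by auto
  from compact_subset_iter_tangent_cone[OF S T this]
  obtain u where u: "u \<in> zero_class T" "\<forall>k\<in>insert p K. k + u \<in> ?S" by blast
  have "compact ((\<lambda>k. k + u) ` insert p K)"
    by (intro compact_continuous_image continuous_intros compact_insert K)
  moreover have "(\<lambda>k. k + u) ` insert p K \<subseteq> ?S" using u(2) by blast
  ultimately obtain s0 where s0: "s0 > 0"
    and s0': "\<And>t k. s0 \<le> t \<Longrightarrow> k \<in> (\<lambda>k. k + u) ` insert p K \<Longrightarrow> k + t *\<^sub>R z \<in> C"
    using compact_subset_tangent_cone[OF C z] by metis
  \<comment> \<open>Since \<open>exp \<delta> * e = exp \<delta> - 1\<close>, scaling
    \<open>p + u + e s z\<close> by \<open>exp \<delta>\<close> gives exactly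
    \<open>exp \<delta> (p + v) - s z\<close>.\<close>
  define e where "e = 1 - exp (- \<delta>)"
  have e: "e > 0" using \<delta> by (simp add: e_def)
  \<comment> \<open>The three bounds put \<open>K + v\<close> into \<open>C\<close>, put
    \<open>p + u + e s z\<close> into \<open>C\<close>, and make \<open>norm (p + u) / s\<close>
    less than \<open>\<eta>\<close>.\<close>
  define s where "s = Max {s0, s0 / e, norm (p + u) / \<eta> + 1}"
  have s: "s0 \<le> s" "s0 / e \<le> s" "norm (p + u) / \<eta> + 1 \<le> s" by (auto simp: s_def)
  have spos: "s > 0" using s(1) s0 by simp
  define v where "v = u + s *\<^sub>R z"
  have vT: "v \<in> zero_class T"
    unfolding v_def by (intro subspace_add subspace_scale subspace_zero_class ocT u zT)
  have "k + v \<in> C" if "k \<in> K" for k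
    using s0'[OF s(1), of "k + u"] that by (simp add: v_def add.assoc)
  moreover have "exp \<delta> *\<^sub>R (p + v) - s *\<^sub>R z \<in> C"
  proof -
    have "s0 \<le> e * s" using s(2) e by (simp add: field_simps)
    from s0'[OF this, of "p + u"] have "exp \<delta> *\<^sub>R ((p + u) + (e * s) *\<^sub>R z) \<in> C"
      by (intro open_cone_scale[OF C]) auto
    moreover have "exp \<delta> * e = exp \<delta> - 1" by (simp add: e_def exp_minus algebra_simps)
    then have "exp \<delta> *\<^sub>R ((p + u) + (e * s) *\<^sub>R z) = exp \<delta> *\<^sub>R (p + v) - s *\<^sub>R z"
      by (simp add: v_def scaleR_add_right mult.assoc[symmetric] left_diff_distrib scaleR_diff_left)
    ultimately show ?thesis by simp
  qed
  moreover have "dist ((1/s) *\<^sub>R (p + v)) z < \<eta>"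
  proof -
    have "(1/s) *\<^sub>R (p + v) - z = (1/s) *\<^sub>R (p + u)" using spos by (simp add: v_def algebra_simps)
    then have "dist ((1/s) *\<^sub>R (p + v)) z = norm (p + u) / s"
      using spos unfolding dist_norm by (simp only: norm_scaleR) simp
    moreover have "norm (p + u) < \<eta> * s" using s(3) \<eta> by (simp add: field_simps)
    ultimately show ?thesis using spos by (simp add: pos_divide_less_eq)
  qed
  ultimately show ?thesis using vT spos by blast
qed

text \<open>The last two properties bound both Funk distances between consecutive terms \<open>p + v n\<close> up to
  the summable error \<open>(1/2)^n\<close>; the one before them makes the next step of the choice possible.\<close>

lemma approximating_sequence:
  fixes C :: "'a::euclidean_space set"
  assumes C: "open_cone C" and z: "z \<in> frontier C" and T: "T \<in> iter_tangent_cones (tangent_cone C z)"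
    and p: "p \<in> T"
  shows "\<exists>v s. (\<forall>n. v n \<in> zero_class T) \<and> (\<forall>n. s n > 0) \<and> (\<forall>n. p + v n \<in> C) \<and>
    (\<forall>q\<in>T. \<forall>\<^sub>F n in sequentially. q + v n \<in> C) \<and>
    (\<lambda>n. (1 / s n) *\<^sub>R (p + v n)) \<longlonglongrightarrow> z \<and>
    (\<forall>n. exp ((1/2)^n) *\<^sub>R (p + v n) - s n *\<^sub>R z \<in> C) \<and>
    (\<forall>n. exp ((1/2)^n) *\<^sub>R (p + v (Suc n)) - (p + v n) \<in> C) \<and>
    (\<forall>n. (exp ((1/2)^n) / s n) *\<^sub>R (p + v n) - (1 / s (Suc n)) *\<^sub>R (p + v (Suc n)) \<in> C)"
proof -
  let ?S = "tangent_cone C z"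
  have S: "open_cone ?S" by (rule open_cone_tangent_cone[OF C z])
  have ocT: "open_cone T" "?S \<subseteq> T" using iter_tangent_cones_open_cone[OF S T] by auto
  \<comment> \<open>The exhaustion by compact sets is what brings every point of \<open>T\<close>
    into \<open>C\<close> eventually.\<close>
  obtain K where K: "\<And>n. compact (K n)" "\<And>n. K n \<subseteq> T" "\<And>n. K n \<subseteq> interior (K (Suc n))" "\<Union>(range K) = T"
    using open_Union_compact_subsets[OF open_cone_open[OF ocT(1)]] by metis
  have Kmono: "K m \<subseteq> K n" if "m \<le> n" for m n
    using that
  proof (induction n rule: dec_induct)
    case (step n)
    then show ?case using K(3)[of n] interior_subset by blast
  qed simp
  define P where "P n vs \<longleftrightarrow> fst vs \<in> zero_class T \<and> snd vs > 0 \<and> p + fst vs \<in> C \<and>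
      (\<forall>k\<in>K n. k + fst vs \<in> C) \<and> exp ((1/2)^n) *\<^sub>R (p + fst vs) - snd vs *\<^sub>R z \<in> C \<and>
      dist ((1 / snd vs) *\<^sub>R (p + fst vs)) z < (1/2)^n" for n and vs :: "'a \<times> real"
  define Q where "Q n vs vs' \<longleftrightarrow> exp ((1/2)^n) *\<^sub>R (p + fst vs') - (p + fst vs) \<in> C \<and>
      (exp ((1/2)^n) / snd vs) *\<^sub>R (p + fst vs) - (1 / snd vs') *\<^sub>R (p + fst vs') \<in> C"
    for n :: nat and vs vs' :: "'a \<times> real"
  have ex: "\<exists>vs. P n vs \<and> q + fst vs \<in> C \<and> dist ((1 / snd vs) *\<^sub>R (p + fst vs)) z < \<eta>"
    if q: "q \<in> T" and \<eta>: "\<eta> > 0" for n q \<eta>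
  proof -
    have "compact (insert p (insert q (K n)))" "insert p (insert q (K n)) \<subseteq> T"
      using K(1,2) p q by auto
    moreover have "min ((1/2)^n) \<eta> > 0" using \<eta> by simp
    ultimately obtain v s where v: "v \<in> zero_class T" "s > 0" "\<forall>k\<in>insert p (insert q (K n)). k + v \<in> C"
        "exp ((1/2)^n) *\<^sub>R (p + v) - s *\<^sub>R z \<in> C" "dist ((1/s) *\<^sub>R (p + v)) z < min ((1/2)^n) \<eta>"
      using approximating_translation[OF C z T p, where \<delta>="(1/2)^n"]
      by (metis zero_less_power half_gt_zero zero_less_one)
    then show ?thesis by (intro exI[of _ "(v, s)"]) (simp add: P_def)
  qed
  have step: "\<exists>vs'. P (Suc n) vs' \<and> Q n vs vs'" if P: "P n vs" for n vs
  proof -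
    define v s where "v = fst vs" and "s = snd vs"
    have vs: "v \<in> zero_class T" "s > 0" "exp ((1/2)^n) *\<^sub>R (p + v) - s *\<^sub>R z \<in> C"
      using P by (auto simp: P_def v_def s_def)
    define e :: real where "e = exp (- ((1/2)^n))"
    have e: "0 < e" "e < 1" by (auto simp: e_def)
    \<comment> \<open>This is \<open>p - e (p + v)\<close>, chosen so that
      \<open>exp ((1/2)^n) = 1/e\<close> times \<open>q + v'\<close> equals
      \<open>exp ((1/2)^n) (p + v') - (p + v)\<close>. It lies in \<open>T\<close> because
      \<open>e < 1\<close> and \<open>v\<close> is a lineality vector.\<close>
    define q where "q = (1 - e) *\<^sub>R p + (- e) *\<^sub>R v"
    have q: "q \<in> T" unfolding q_def
      by (intro open_cone_add_zero_class[OF ocT(1)] open_cone_scale[OF ocT(1) p]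
          subspace_scale[OF subspace_zero_class[OF ocT(1)] vs(1)]) (use e in simp)
    define w where "w = (exp ((1/2)^n) / s) *\<^sub>R (p + v)"
    have "(1/s) *\<^sub>R (exp ((1/2)^n) *\<^sub>R (p + v) - s *\<^sub>R z) \<in> C"
      using vs by (intro open_cone_scale[OF C]) auto
    then have "w - z \<in> C" using vs(2) by (simp add: w_def scaleR_diff_right)
    \<comment> \<open>By openness, \<open>z\<close> may be replaced in \<open>w - z\<close> by any
      normalised next term within \<open>\<eta>\<close> of it.\<close>
    then obtain \<eta> where \<eta>: "\<eta> > 0" "ball (w - z) \<eta> \<subseteq> C"
      using open_cone_open[OF C] open_contains_ball by blast
    obtain vs' where vs': "P (Suc n) vs'" "q + fst vs' \<in> C" "dist ((1 / snd vs') *\<^sub>R (p + fst vs')) z < \<eta>"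
      using ex[OF q \<eta>(1)] by blast
    have "w - (1 / snd vs') *\<^sub>R (p + fst vs') \<in> ball (w - z) \<eta>"
      using vs'(3) by (simp add: dist_norm)
    then have "w - (1 / snd vs') *\<^sub>R (p + fst vs') \<in> C" using \<eta>(2) by blast
    moreover have "exp ((1/2)^n) *\<^sub>R (p + fst vs') - (p + v) \<in> C"
    proof -
      have "exp ((1/2)^n) *\<^sub>R (q + fst vs') \<in> C" using vs'(2) by (intro open_cone_scale[OF C]) auto
      moreover have ee: "exp ((1/2)^n) * e = 1" by (simp add: e_def exp_minus)
      then have "exp ((1/2)^n) *\<^sub>R (q + fst vs') = exp ((1/2)^n) *\<^sub>R (p + fst vs') - (p + v)"
        by (simp add: q_def algebra_simps)
      ultimately show ?thesis by simp
    qed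
    ultimately have "Q n vs vs'" by (simp add: Q_def w_def v_def s_def)
    then show ?thesis using vs'(1) by blast
  qed
  have "\<exists>vs. P 0 vs" using ex[OF p zero_less_one, of 0] by blast
  from dependent_nat_choice[of P Q, OF this step]
  obtain f where f: "\<And>n. P n (f n)" "\<And>n. Q n (f n) (f (Suc n))" by blast
  show ?thesis
  proof (intro exI[of _ "\<lambda>n. fst (f n)"] exI[of _ "\<lambda>n. snd (f n)"] conjI ballI)
    fix q assume "q \<in> T"
    then obtain m where m: "q \<in> K m" using K(4) by blast
    show "\<forall>\<^sub>F n in sequentially. q + fst (f n) \<in> C"
      using eventually_ge_at_top[of m]
    proof eventually_elim
      case (elim n)
      then have "q \<in> K n" using m Kmono by blast
      then show ?case using f(1)[of n] by (simp add: P_def)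
    qed
  next
    show "(\<lambda>n. (1 / snd (f n)) *\<^sub>R (p + fst (f n))) \<longlonglongrightarrow> z"
    proof (rule metric_tendsto_imp_tendsto)
      show "(\<lambda>n. (1/2::real)^n) \<longlonglongrightarrow> 0" by (rule LIMSEQ_power_zero) simp
      show "\<forall>\<^sub>F n in sequentially. dist ((1 / snd (f n)) *\<^sub>R (p + fst (f n))) z \<le> dist ((1/2::real)^n) 0"
        using f(1) by (intro always_eventually) (auto simp: P_def intro: less_imp_le)
    qed
  qed (use f in \<open>auto simp: P_def Q_def\<close>)
qed

text \<open>Evaluate at \<open>exp a b + z\<close> for very negative \<open>a\<close>: the
  \<open>T\<close> part equals \<open>a\<close> because \<open>z\<close> is a lineality vector of
  \<open>T\<close>, and the \<open>z\<close> part is bounded above. Normalised Hilbert distances,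
  however, are bounded below.\<close>

lemma limit_form_not_interior:
  assumes C: "open_cone C" "contains_no_lines C" "b \<in> C"
    and z: "z \<in> frontier C" "z \<noteq> 0" and T: "T \<in> iter_tangent_cones (tangent_cone C z)" and p: "p \<in> T"
    and q: "q \<in> C"
  shows "\<exists>y\<in>C. r_fun b C z y + f_fun b T p y \<noteq> Hilbert C y q - Hilbert C b q"
proof (rule ccontr)
  let ?S = "tangent_cone C z"
  have S: "open_cone ?S" by (rule open_cone_tangent_cone[OF C(1) z(1)])
  have ocT: "open_cone T" "?S \<subseteq> T" using iter_tangent_cones_open_cone[OF S T] by auto
  have zT: "z \<in> zero_class T"
    using zero_class_tangent_cone[OF C(1) z(1)] zero_class_mono[OF ocT(2)] by blast
  have zcl: "z \<in> closure C" using z frontier_open_cone[OF C(1)] by blast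
  have bT: "b \<in> T" using C(3) subset_tangent_cone[OF C(1) z(1)] ocT(2) by blast
  assume "\<not> ?thesis"
  then have eq: "r_fun b C z y + f_fun b T p y = Hilbert C y q - Hilbert C b q" if "y \<in> C" for y
    using that by blast
  define D where "D = Funk C z b - Hilbert C b q"
  have bound: "D \<le> a" for a :: real
  proof -
    define y where "y = exp a *\<^sub>R b + z"
    have eb: "exp a *\<^sub>R b \<in> C" by (intro open_cone_scale[OF C(1,3)]) simp
    have y: "y \<in> C" unfolding y_def using closure_add_open_cone[OF C(1) zcl eb] by (simp add: add.commute)
    have "Mfun C z y \<le> 1"
      using Mfun_le_iff[OF C(1) y, of 1 z] eb closure_subset[of C] by (auto simp: y_def)
    then have "Funk C z y \<le> 0"
      unfolding Funk_def using Mfun_frontier_pos[OF C(1,2) zcl z(2) y] by simp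
    moreover have "Funk T y p = a + Funk T b p"
      using Funk_scale_left[OF ocT(1) p Mfun_pos_cone[OF ocT(1) p bT], of "exp a"]
      by (simp add: Funk_def y_def Mfun_zero_class_left[OF ocT(1) p zT])
    moreover have "0 \<le> Hilbert C y q" by (rule Hilbert_nonneg[OF C(1) y q])
    ultimately show ?thesis using eq[OF y] by (simp add: D_def r_fun_def f_fun_def)
  qed
  from bound[of "D - 1"] show False by simp
qed

text \<open>The points \<open>x n = p + v n\<close> stay in one class modulo the lineality space of
  \<open>T\<close>, so gauges in \<open>T\<close> are constant along them. Up to bounded errors the
  length of the path comes from the reverse Funk distances, which grow like
  \<open>ln (s n)\<close>.\<close>

lemma limit_form_Busemann:
  fixes C :: "'a::euclidean_space set"
  assumes C: "open_cone C" "contains_no_lines C" "b \<in> C"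
    and z: "z \<in> frontier C" "z \<noteq> 0" and T: "T \<in> iter_tangent_cones (tangent_cone C z)" and p: "p \<in> T"
  shows "restrict (\<lambda>x. r_fun b C z x + f_fun b T p x) C \<in> Busemann_points C (Hilbert C) b"
proof -
  let ?S = "tangent_cone C z" and ?g = "restrict (\<lambda>x. r_fun b C z x + f_fun b T p x) C"
  have S: "open_cone ?S" by (rule open_cone_tangent_cone[OF C(1) z(1)])
  have ocT: "open_cone T" "?S \<subseteq> T" using iter_tangent_cones_open_cone[OF S T] by auto
  have CT: "C \<subseteq> T" using subset_tangent_cone[OF C(1) z(1)] ocT(2) by blast
  have zcl: "z \<in> closure C" using z frontier_open_cone[OF C(1)] by blast
  obtain v s where v: "\<forall>n. v n \<in> zero_class T" and s: "\<forall>n. s n > 0" and vC: "\<forall>n. p + v n \<in> C"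
    and ev: "\<forall>q\<in>T. \<forall>\<^sub>F n in sequentially. q + v n \<in> C"
    and lim: "(\<lambda>n. (1 / s n) *\<^sub>R (p + v n)) \<longlonglongrightarrow> z"
    and above: "\<forall>n. exp ((1/2)^n) *\<^sub>R (p + v n) - s n *\<^sub>R z \<in> C"
    and incr: "\<forall>n. exp ((1/2)^n) *\<^sub>R (p + v (Suc n)) - (p + v n) \<in> C"
    and decr: "\<forall>n. (exp ((1/2)^n) / s n) *\<^sub>R (p + v n) - (1 / s (Suc n)) *\<^sub>R (p + v (Suc n)) \<in> C"
    using approximating_sequence[OF C(1) z(1) T p] by (elim exE conjE)
  note v = v[rule_format] and s = s[rule_format] and vC = vC[rule_format] and ev = ev[rule_format]
    and above = above[rule_format] and incr = incr[rule_format] and decr = decr[rule_format]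
  define x where "x n = p + v n" for n
  have x: "x n \<in> C" for n unfolding x_def by (rule vC)
  have Mx: "Mfun T y (x n) = Mfun T y p" for y n
    unfolding x_def by (rule Mfun_zero_class_right[OF ocT(1) p v])
  have F1: "Funk C (x n) (x (Suc n)) \<le> (1/2)^n" for n
    using Funk_le_iff[OF C(1) x x] incr closure_subset[of C] by (auto simp: x_def)
  \<comment> \<open>The normalised terms nearly decrease; undoing the scaling produces the increment
    of \<open>ln (s n)\<close>.\<close>
  have F2: "Funk C (x (Suc n)) (x n) \<le> (1/2)^n + ln (s (Suc n)) - ln (s n)" for n
  proof -
    have xs: "(1 / s n) *\<^sub>R x n \<in> C" using s by (intro open_cone_scale[OF C(1) x]) simp
    have "Funk C ((1 / s (Suc n)) *\<^sub>R x (Suc n)) ((1 / s n) *\<^sub>R x n) \<le> (1/2)^n"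
      using Funk_le_iff[OF C(1) open_cone_scale[OF C(1) x] open_cone_scale[OF C(1) x],
          of "1 / s n" "1 / s (Suc n)" "Suc n" n] s decr[of n] closure_subset[of C]
      by (auto simp: x_def)
    moreover have "Funk C ((1 / s (Suc n)) *\<^sub>R x (Suc n)) ((1 / s n) *\<^sub>R x n)
        = ln (1 / s (Suc n)) + (Funk C (x (Suc n)) (x n) - ln (1 / s n))"
      using Funk_scale_left[OF C(1) xs Mfun_pos_cone[OF C(1) xs x[of "Suc n"]], of "1 / s (Suc n)"]
        Funk_scale_right[OF C(1) x[of n] x[of "Suc n"], of "1 / s n"] s by simp
    ultimately show ?thesis using s[of n] s[of "Suc n"] by (simp add: ln_div)
  qed
  \<comment> \<open>Two errors \<open>(1/2)^i\<close> per step add up to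
    \<open>4 - 4 * (1/2)^l\<close>, and the logarithms telescope.\<close>
  have sum: "(\<Sum>i=1..l. Hilbert C (x (i - 1)) (x i)) \<le> 4 - 4 * (1/2)^l + ln (s l) - ln (s 0)" for l
  proof (induction l)
    case (Suc l)
    then show ?case using F1[of l] F2[of l] by (simp add: Hilbert_def)
  qed simp
  have lower1: "0 \<le> Funk C (x 0) (x l)" for l
  proof -
    have "Mfun T (x 0) (x l) \<le> Mfun C (x 0) (x l)" by (rule Mfun_antimono[OF C(1) ocT(1) CT x])
    moreover have "Mfun T (x 0) (x l) = 1"
      using Mfun_self[OF ocT(1), of "x 0"] x[of 0] CT by (auto simp: Mx)
    ultimately show ?thesis by (simp add: Funk_def)
  qed
  \<comment> \<open>By \<open>above\<close>, \<open>s l z \<le> exp ((1/2)^l) x l\<close>, so the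
    reverse distance attains the growth \<open>ln (s l)\<close> up to a constant.\<close>
  have lower2: "ln (s l) - 1 + Funk C z (x 0) \<le> Funk C (x l) (x 0)" for l
  proof -
    have zpos: "0 < Mfun C z (x 0)" by (rule Mfun_frontier_pos[OF C(1,2) zcl z(2) x])
    have "s l * Mfun C z (x 0) \<le> exp ((1/2)^l) * Mfun C (x l) (x 0)"
      using Mfun_le_trans_left[OF C(1) x[of 0], of "exp ((1/2)^l) *\<^sub>R x l" "s l *\<^sub>R z"] above[of l]
        closure_subset[of C] s[of l]
      by (auto simp: x_def Mfun_scale_left[OF C(1) vC])
    moreover have "0 < s l * Mfun C z (x 0)" using s zpos by simp
    ultimately have "ln (s l * Mfun C z (x 0)) \<le> ln (exp ((1/2)^l) * Mfun C (x l) (x 0))"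
      by (subst ln_le_cancel_iff) auto
    then have "ln (s l) + Funk C z (x 0) \<le> (1/2)^l + Funk C (x l) (x 0)"
      using s[of l] zpos Mfun_pos_cone[OF C(1) x[of 0] x[of l]] by (simp add: Funk_def ln_mult)
    moreover have "(1/2::real)^l \<le> 1" by (rule power_le_one) auto
    ultimately show ?thesis by linarith
  qed
  have "almost_geodesic C (Hilbert C) x"
    unfolding almost_geodesic_def
  \<comment> \<open>Here 4 bounds the summed errors and 1 the loss in \<open>lower2\<close>; the
    absolute value covers the terms that depend only on the start.\<close>
  proof (intro conjI allI exI[of _ "5 + \<bar>ln (s 0) + Funk C z (x 0)\<bar>"] impI)
    show "0 < 5 + \<bar>ln (s 0) + Funk C z (x 0)\<bar>" by simp
    fix l :: nat
    have "(1/2::real)^l \<ge> 0" by simp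
    then show "(\<Sum>i=1..l. Hilbert C (x (i - 1)) (x i))
        \<le> Hilbert C (x 0) (x l) + (5 + \<bar>ln (s 0) + Funk C z (x 0)\<bar>)"
      using sum[of l] lower1[of l] lower2[of l] unfolding Hilbert_def by linarith
  qed (rule x)
  moreover have "converges_d C (Hilbert C) b x ?g"
  proof -
    \<comment> \<open>Gauges in \<open>C\<close> are at least those in \<open>T\<close>. For an
      upper bound \<open>a\<close>, the point \<open>p - y/a\<close> is in \<open>T\<close>, and
      adding \<open>v n\<close> eventually moves it into \<open>C\<close>.\<close>
    have M: "(\<lambda>n. Mfun C y (x n)) \<longlonglongrightarrow> Mfun T y p" if y: "y \<in> C" for y
    proof (rule order_tendstoI)
      fix a assume "a < Mfun T y p"
      then have "a < Mfun C y (x n)" for n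
        using Mfun_antimono[OF C(1) ocT(1) CT x, of y n] Mx[of y n] by simp
      then show "\<forall>\<^sub>F n in sequentially. a < Mfun C y (x n)" by simp
    next
      fix a assume a: "Mfun T y p < a"
      then have a0: "a > 0" using Mfun_nonneg[OF ocT(1) p, of y] by simp
      then have "a *\<^sub>R p - y \<in> T" using Mfun_less_iff[OF ocT(1) p a0] a by simp
      then have "(1/a) *\<^sub>R (a *\<^sub>R p - y) \<in> T" using a0 by (intro open_cone_scale[OF ocT(1)]) auto
      from ev[OF this] show "\<forall>\<^sub>F n in sequentially. Mfun C y (x n) < a"
      proof eventually_elim
        case (elim n)
        from open_cone_scale[OF C(1) elim a0] have "a *\<^sub>R x n - y \<in> C"
          using a0 by (simp add: x_def algebra_simps)
        then show ?case using Mfun_less_iff[OF C(1) x a0] by blast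
      qed
    qed
    have F: "(\<lambda>n. Funk C y (x n)) \<longlonglongrightarrow> Funk T y p" if y: "y \<in> C" for y
      unfolding Funk_def using Mfun_pos_cone[OF ocT(1) p, of y] CT y by (intro tendsto_ln M) auto
    have "(\<lambda>n. Hilbert C y (x n) - Hilbert C b (x n)) \<longlonglongrightarrow> ?g y" if y: "y \<in> C" for y
    proof -
      have "(\<lambda>n. Funk C (x n) y - Funk C (x n) b) \<longlonglongrightarrow> r_fun b C z y"
        by (rule Funk_diff_tendsto_r_fun[where c="\<lambda>n. 1 / s n" and x=x, OF C y x _ zcl z(2)])
          (use s lim in \<open>simp_all add: x_def\<close>)
      from tendsto_add[OF this tendsto_diff[OF F[OF y] F[OF C(3)]]]
      show ?thesis using y by (simp add: Hilbert_def f_fun_def algebra_simps)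
    qed
    then show ?thesis unfolding converges_d_def by blast
  qed
  moreover have "\<not> (\<exists>q\<in>C. \<forall>y\<in>C. ?g y = Hilbert C y q - Hilbert C b q)"
    using limit_form_not_interior[OF C z T p] by auto
  ultimately show ?thesis unfolding Busemann_points_def by auto
qed

theorem theorem1p1:
  fixes C :: "'a::euclidean_space set" and b :: 'a
  assumes "open_cone C" and "contains_no_lines C" and "b \<in> C"
  shows "Busemann_points C (Hilbert C) b =
    {restrict (\<lambda>x. r_fun b C z x + f_fun b T p x) C | z T p.
       z \<in> frontier C - {0} \<and> T \<in> iter_tangent_cones (tangent_cone C z) \<and> p \<in> T}"
proof (intro subset_antisym subsetI)
  fix g assume "g \<in> Busemann_points C (Hilbert C) b"
  from Busemann_point_form[OF assms this]
  show "g \<in> {restrict (\<lambda>x. r_fun b C z x + f_fun b T p x) C | z T p.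
       z \<in> frontier C - {0} \<and> T \<in> iter_tangent_cones (tangent_cone C z) \<and> p \<in> T}"
    by blast
qed (use limit_form_Busemann[OF assms] in auto)

end
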